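(* Let $(\mathcal C,\phi,\Delta)$ be a homogeneous categorical Garside structure with set of simple morphisms $S$, let $x$ be an object of $\mathcal C$, and let $G_x$ be the associated weak Garside group. Then the weak Cayley graph $\operatorname{Cay}(G_x,S)$ and its quotient $\operatorname{Cay}(G_x,S)/\langle\Delta_x\rangle$ are weakly modular graphs. In particular, if $\mathcal C$ has a single object, so that $G=G_x$ is a Garside group with Garside element $\Delta$, then the Cayley graph $\operatorname{Cay}(G,S)$ and its quotient by $\langle\Delta\rangle$ are weakly modular graphs.
   Context: Garside structures. Let $\mathcal C$ be a small category; morphisms compose like paths: $x\stackrel{f}{\to}y\stackrel{g}{\to}z$ composes to $x\stackrel{fg}{\to}z$. $\mathcal C_{x\to}$ (resp. $\mathcal C_{\to x}$) is the set of morphisms with source (resp. target) $x$. Write $f\preccurlyeq g$ if $g=fh$ for some morphism $h$, and $g\succcurlyeq f$ if $g=hf$ for some morphism $h$. An atom is a nontrivial morphism that is not a product of two nontrivial morphisms. $\mathcal C$ is cancellative if $afb=agb$ implies $f=g$. $\mathcal C$ is homogeneous if there is a function $l$ from morphisms to $\mathbb Z_{\ge0}$ with $l(fg)=l(f)+l(g)$ and $l(f)=0$ if and only if $f$ is a unit (identity morphism). Given an automorphism $\phi$ of $\mathcal C$ and a natural transformation $\Delta$ from the identity functor to $\phi$, with components $\Delta_x:x\to\phi(x)$, a morphism $f:x\to y$ is simple if there is $f^*:y\to\phi(x)$ with $ff^*=\Delta_x$. A homogeneous categorical Garside structure is a triple $(\mathcal C,\phi,\Delta)$ such that: (1) $\phi$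 is an automorphism of $\mathcal C$ and $\Delta$ is a natural transformation from the identity functor to $\phi$; (2) $\mathcal C$ is homogeneous and cancellative; (3) all atoms are simple; (4) for every object $x$, $(\mathcal C_{x\to},\preccurlyeq)$ and $(\mathcal C_{\to x},\succcurlyeq)$ are lattices. The associated Garside groupoid $\mathcal G$ is the enveloping groupoid of $\mathcal C$ (obtained by adding formal inverses to all morphisms); $\phi$ extends to $\mathcal G$. The weak Garside group $G_x$ is the group of morphisms of $\mathcal G$ from $x$ to itself; it is called a Garside group when $\mathcal C$ has a single object. Graphs. Let $L_x$ be the set of morphisms of $\mathcal G$ with source $x$. The weak Cayley graph $\operatorname{Cay}(G_x,S)$ has vertex set $L_x$, with an edge between distinct $f$ and $g$ if there is $s\in S$ with $f=gs$ or $g=fs$. The Garside automorphism is the map $f\mapsto\Delta_x\phi(f)$ of $L_x$ (equal to $f\Delta_y$ if $f$ has target $y$). The quotient $\operatorname{Cay}(G_x,S)/\langle\Delta_x\rangle$ is the simplicial graph whose vertices are the orbits of the group generated by the Garside automorphism, two distinct orbits being adjacent if they have adjacent representatives. A simplicial graph $\Gamma$ is endowed with the path metric $d$ in which every edge has length $1$. $\Gamma$ is weakly modular if for every vertex $x$ of $\Gamma$ and every integer $n\geq 2$ the following hold. (Triangle condition) For any two adjacent vertices $x_1,x_2$ with $d(x,x_1)=d(x,x_2)=n$, there is a vertex $y$ with $d(y,x)=n-1$ and $d(y,x_1)=d(y,x_2)=1$. (Quadrangle condition) For any two vertices $x_1,x_2$ with $d(x,x_1)=d(x,x_2)=n$ and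 $d(x_1,x_2)=2$ such that $x_1,x_2$ are both adjacent to a common vertex at distance $n+1$ from $x$, there is a vertex $y$ with $d(y,x)=n-1$ and $d(y,x_1)=d(y,x_2)=1$. *)

theory Defs
  imports Main "HOL-Library.Extended_Nat" "HOL-Algebra.Bij" "HOL-Algebra.Lattice"
    "HOL-Algebra.Generated_Groups" "HOL-Algebra.Group_Action" "HOL-Algebra.Left_Coset"
begin

section \<open>Simplicial graphs, path metric, weak modularity\<close>

record 'v graph =
  verts :: "'v set"
  edges :: "('v \<times> 'v) set"

definition simplicial_graph :: "'v graph \<Rightarrow> bool" where
  "simplicial_graph \<Gamma> \<longleftrightarrow>
     edges \<Gamma> \<subseteq> verts \<Gamma> \<times> verts \<Gamma> \<and> sym (edges \<Gamma>) \<and> irrefl (edges \<Gamma>)"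

text \<open>Length of a shortest edge path; the infimum of the empty set is \<open>\<infinity>\<close>, so vertices in
  different components are at infinite distance.\<close>

definition gdist :: "'v graph \<Rightarrow> 'v \<Rightarrow> 'v \<Rightarrow> enat" where
  "gdist \<Gamma> u v = (INF k \<in> {k. (u, v) \<in> edges \<Gamma> ^^ k}. enat k)"

definition triangle_condition :: "'v graph \<Rightarrow> 'v \<Rightarrow> nat \<Rightarrow> bool" where
  "triangle_condition \<Gamma> x n \<longleftrightarrow>
     (\<forall>x1\<in>verts \<Gamma>. \<forall>x2\<in>verts \<Gamma>.
        (x1, x2) \<in> edges \<Gamma> \<and> gdist \<Gamma> x x1 = enat n \<and> gdist \<Gamma> x x2 = enat n \<longrightarrow>
        (\<exists>y\<in>verts \<Gamma>. gdist \<Gamma> y x = enat (n - 1) \<and> gdist \<Gamma> y x1 = 1 \<and> gdist \<Gamma> y x2 = 1))"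

definition quadrangle_condition :: "'v graph \<Rightarrow> 'v \<Rightarrow> nat \<Rightarrow> bool" where
  "quadrangle_condition \<Gamma> x n \<longleftrightarrow>
     (\<forall>x1\<in>verts \<Gamma>. \<forall>x2\<in>verts \<Gamma>.
        gdist \<Gamma> x x1 = enat n \<and> gdist \<Gamma> x x2 = enat n \<and> gdist \<Gamma> x1 x2 = 2 \<and>
        (\<exists>z\<in>verts \<Gamma>. (x1, z) \<in> edges \<Gamma> \<and> (x2, z) \<in> edges \<Gamma> \<and> gdist \<Gamma> x z = enat (n + 1)) \<longrightarrow>
        (\<exists>y\<in>verts \<Gamma>. gdist \<Gamma> y x = enat (n - 1) \<and> gdist \<Gamma> y x1 = 1 \<and> gdist \<Gamma> y x2 = 1))"

definition weakly_modular :: "'v graph \<Rightarrow> bool" where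
  "weakly_modular \<Gamma> \<longleftrightarrow> simplicial_graph \<Gamma> \<and>
     (\<forall>x\<in>verts \<Gamma>. \<forall>n\<ge>2. triangle_condition \<Gamma> x n \<and> quadrangle_condition \<Gamma> x n)"

text \<open>Quotient of a graph by a partition \<open>P\<close> of its vertices.\<close>

definition quotient_graph :: "'v graph \<Rightarrow> 'v set set \<Rightarrow> 'v set graph" where
  "quotient_graph \<Gamma> P =
     \<lparr>verts = P,
      edges = {(A, B). A \<in> P \<and> B \<in> P \<and> A \<noteq> B \<and> (\<exists>a\<in>A. \<exists>b\<in>B. (a, b) \<in> edges \<Gamma>)}\<rparr>"

text \<open>The orbits on \<open>V\<close> of the group of permutations of \<open>V\<close> generated by \<open>\<sigma>\<close>. The
  restriction is needed since \<^const>\<open>BijGroup\<close> consists of extensional functions.\<close>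

definition cyclic_orbits :: "'v set \<Rightarrow> ('v \<Rightarrow> 'v) \<Rightarrow> 'v set set" where
  "cyclic_orbits V \<sigma> = orbits (subgroup_generated (BijGroup V) {restrict \<sigma> V}) V (\<lambda>\<tau>. \<tau>)"

definition cayley_graph :: "('a, 'b) monoid_scheme \<Rightarrow> 'a set \<Rightarrow> 'a graph" where
  "cayley_graph G S =
     \<lparr>verts = carrier G,
      edges = {(f, g). f \<in> carrier G \<and> g \<in> carrier G \<and> f \<noteq> g \<and>
                 (\<exists>s\<in>S. f = g \<otimes>\<^bsub>G\<^esub> s \<or> g = f \<otimes>\<^bsub>G\<^esub> s)}\<rparr>"

section \<open>Small categories\<close>

text \<open>Composition is in path order, and meaningful only for composable morphisms.\<close>

record ('o, 'm) cat =
  Ob :: "'o set"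
  Mor :: "'m set"
  src :: "'m \<Rightarrow> 'o"
  tgt :: "'m \<Rightarrow> 'o"
  ident :: "'o \<Rightarrow> 'm"
  cmp :: "'m \<Rightarrow> 'm \<Rightarrow> 'm" (infixl \<open>\<cdot>\<index>\<close> 70)

locale small_category =
  fixes C :: "('o, 'm) cat" (structure)
  assumes src_in [intro, simp]: "f \<in> Mor C \<Longrightarrow> src C f \<in> Ob C"
    and tgt_in [intro, simp]: "f \<in> Mor C \<Longrightarrow> tgt C f \<in> Ob C"
    and ident_in [intro, simp]: "x \<in> Ob C \<Longrightarrow> ident C x \<in> Mor C"
    and src_ident [simp]: "x \<in> Ob C \<Longrightarrow> src C (ident C x) = x"
    and tgt_ident [simp]: "x \<in> Ob C \<Longrightarrow> tgt C (ident C x) = x"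
    and cmp_in [intro, simp]:
      "\<lbrakk>f \<in> Mor C; g \<in> Mor C; tgt C f = src C g\<rbrakk> \<Longrightarrow> f \<cdot> g \<in> Mor C"
    and src_cmp [simp]:
      "\<lbrakk>f \<in> Mor C; g \<in> Mor C; tgt C f = src C g\<rbrakk> \<Longrightarrow> src C (f \<cdot> g) = src C f"
    and tgt_cmp [simp]:
      "\<lbrakk>f \<in> Mor C; g \<in> Mor C; tgt C f = src C g\<rbrakk> \<Longrightarrow> tgt C (f \<cdot> g) = tgt C g"
    and ident_left [simp]: "f \<in> Mor C \<Longrightarrow> ident C (src C f) \<cdot> f = f"
    and ident_right [simp]: "f \<in> Mor C \<Longrightarrow> f \<cdot> ident C (tgt C f) = f"
    and cmp_assoc:
      "\<lbrakk>f \<in> Mor C; g \<in> Mor C; h \<in> Mor C; tgt C f = src C g; tgt C g = src C h\<rbrakk>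
        \<Longrightarrow> f \<cdot> g \<cdot> h = f \<cdot> (g \<cdot> h)"

text \<open>In \<open>to_poset\<close>, \<open>le f g\<close> stands for \<open>g \<succcurlyeq> f\<close>.\<close>

definition from_poset :: "('o, 'm) cat \<Rightarrow> 'o \<Rightarrow> 'm gorder" where
  "from_poset C x =
     \<lparr>carrier = {f \<in> Mor C. src C f = x}, eq = (=),
      le = (\<lambda>f g. \<exists>h\<in>Mor C. tgt C f = src C h \<and> g = f \<cdot>\<^bsub>C\<^esub> h)\<rparr>"

definition to_poset :: "('o, 'm) cat \<Rightarrow> 'o \<Rightarrow> 'm gorder" where
  "to_poset C x =
     \<lparr>carrier = {f \<in> Mor C. tgt C f = x}, eq = (=),
      le = (\<lambda>f g. \<exists>h\<in>Mor C. tgt C h = src C f \<and> g = h \<cdot>\<^bsub>C\<^esub> f)\<rparr>"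

definition nontrivial :: "('o, 'm) cat \<Rightarrow> 'm \<Rightarrow> bool" where
  "nontrivial C f \<longleftrightarrow> f \<in> Mor C \<and> f \<notin> ident C ` Ob C"

definition atom :: "('o, 'm) cat \<Rightarrow> 'm \<Rightarrow> bool" where
  "atom C a \<longleftrightarrow> nontrivial C a \<and>
     \<not> (\<exists>f g. nontrivial C f \<and> nontrivial C g \<and> tgt C f = src C g \<and> a = f \<cdot>\<^bsub>C\<^esub> g)"

definition cancellative :: "('o, 'm) cat \<Rightarrow> bool" where
  "cancellative C \<longleftrightarrow>
     (\<forall>a\<in>Mor C. \<forall>b\<in>Mor C. \<forall>f\<in>Mor C. \<forall>g\<in>Mor C.
        tgt C a = src C f \<and> tgt C f = src C b \<and> tgt C a = src C g \<and> tgt C g = src C b \<and>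
        a \<cdot>\<^bsub>C\<^esub> f \<cdot>\<^bsub>C\<^esub> b = a \<cdot>\<^bsub>C\<^esub> g \<cdot>\<^bsub>C\<^esub> b \<longrightarrow> f = g)"

definition homogeneous :: "('o, 'm) cat \<Rightarrow> bool" where
  "homogeneous C \<longleftrightarrow>
     (\<exists>l :: 'm \<Rightarrow> nat.
        (\<forall>f\<in>Mor C. \<forall>g\<in>Mor C. tgt C f = src C g \<longrightarrow> l (f \<cdot>\<^bsub>C\<^esub> g) = l f + l g) \<and>
        (\<forall>f\<in>Mor C. l f = 0 \<longleftrightarrow> f \<in> ident C ` Ob C))"

section \<open>Homogeneous categorical Garside structures\<close>

text \<open>An automorphism is given by its action \<open>\<phi>o\<close> on objects and \<open>\<phi>m\<close> on morphisms.\<close>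

locale cat_automorphism = small_category C
  for C :: "('o, 'm) cat" (structure) +
  fixes \<phi>o :: "'o \<Rightarrow> 'o" and \<phi>m :: "'m \<Rightarrow> 'm"
  assumes bij_ob: "bij_betw \<phi>o (Ob C) (Ob C)"
    and bij_mor: "bij_betw \<phi>m (Mor C) (Mor C)"
    and src_map: "f \<in> Mor C \<Longrightarrow> src C (\<phi>m f) = \<phi>o (src C f)"
    and tgt_map: "f \<in> Mor C \<Longrightarrow> tgt C (\<phi>m f) = \<phi>o (tgt C f)"
    and map_ident: "x \<in> Ob C \<Longrightarrow> \<phi>m (ident C x) = ident C (\<phi>o x)"
    and map_cmp: "\<lbrakk>f \<in> Mor C; g \<in> Mor C; tgt C f = src C g\<rbrakk> \<Longrightarrow> \<phi>m (f \<cdot> g) = \<phi>m f \<cdot> \<phi>m g"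

definition simples :: "('o, 'm) cat \<Rightarrow> ('o \<Rightarrow> 'o) \<Rightarrow> ('o \<Rightarrow> 'm) \<Rightarrow> 'm set" where
  "simples C \<phi>o \<Delta> =
     {f \<in> Mor C. \<exists>h\<in>Mor C. src C h = tgt C f \<and> tgt C h = \<phi>o (src C f) \<and>
                   f \<cdot>\<^bsub>C\<^esub> h = \<Delta> (src C f)}"

locale homogeneous_garside = cat_automorphism C \<phi>o \<phi>m
  for C :: "('o, 'm) cat" (structure) and \<phi>o \<phi>m +
  fixes \<Delta> :: "'o \<Rightarrow> 'm"
  assumes Delta_in: "x \<in> Ob C \<Longrightarrow> \<Delta> x \<in> Mor C"
    and src_Delta: "x \<in> Ob C \<Longrightarrow> src C (\<Delta> x) = x"
    and tgt_Delta: "x \<in> Ob C \<Longrightarrow> tgt C (\<Delta> x) = \<phi>o x"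
    and Delta_natural: "f \<in> Mor C \<Longrightarrow> f \<cdot> \<Delta> (tgt C f) = \<Delta> (src C f) \<cdot> \<phi>m f"
    and is_homogeneous: "homogeneous C"
    and is_cancellative: "cancellative C"
    and atoms_simple: "atom C a \<Longrightarrow> a \<in> simples C \<phi>o \<Delta>"
    and from_lattice: "x \<in> Ob C \<Longrightarrow> lattice (from_poset C x)"
    and to_lattice: "x \<in> Ob C \<Longrightarrow> lattice (to_poset C x)"

section \<open>The enveloping groupoid\<close>

text \<open>Morphisms \<open>x \<rightarrow> y\<close> of the enveloping groupoid are zigzags \<open>(x, w, y)\<close>, that is paths \<open>w\<close>
  from \<open>x\<close> to \<open>y\<close> of morphisms of \<open>C\<close> and their formal inverses, modulo the congruence that
  composes adjacent morphisms of \<open>C\<close>, removes identities, and cancels formal inverses.\<close>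

datatype 'm letter = Fwd 'm | Bwd 'm

primrec letter_mor :: "'m letter \<Rightarrow> 'm" where
  "letter_mor (Fwd f) = f"
| "letter_mor (Bwd f) = f"

primrec letter_src :: "('o, 'm) cat \<Rightarrow> 'm letter \<Rightarrow> 'o" where
  "letter_src C (Fwd f) = src C f"
| "letter_src C (Bwd f) = tgt C f"

primrec letter_tgt :: "('o, 'm) cat \<Rightarrow> 'm letter \<Rightarrow> 'o" where
  "letter_tgt C (Fwd f) = tgt C f"
| "letter_tgt C (Bwd f) = src C f"

fun is_path :: "('o, 'm) cat \<Rightarrow> 'o \<Rightarrow> 'm letter list \<Rightarrow> 'o \<Rightarrow> bool" where
  "is_path C x [] y \<longleftrightarrow> x \<in> Ob C \<and> y = x"
| "is_path C x (a # w) y \<longleftrightarrow>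
     letter_mor a \<in> Mor C \<and> letter_src C a = x \<and> is_path C (letter_tgt C a) w y"

type_synonym ('o, 'm) zigzag = "'o \<times> 'm letter list \<times> 'o"

definition zigzags :: "('o, 'm) cat \<Rightarrow> ('o, 'm) zigzag set" where
  "zigzags C = {(x, w, y). is_path C x w y}"

inductive relator :: "('o, 'm) cat \<Rightarrow> 'm letter list \<Rightarrow> 'm letter list \<Rightarrow> bool" for C where
  relator_cmp:
    "\<lbrakk>f \<in> Mor C; g \<in> Mor C; tgt C f = src C g\<rbrakk> \<Longrightarrow> relator C [Fwd f, Fwd g] [Fwd (f \<cdot>\<^bsub>C\<^esub> g)]"
| relator_ident: "x \<in> Ob C \<Longrightarrow> relator C [Fwd (ident C x)] []"
| relator_inv_right: "f \<in> Mor C \<Longrightarrow> relator C [Fwd f, Bwd f] []"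
| relator_inv_left: "f \<in> Mor C \<Longrightarrow> relator C [Bwd f, Fwd f] []"

inductive zstep :: "('o, 'm) cat \<Rightarrow> ('o, 'm) zigzag \<Rightarrow> ('o, 'm) zigzag \<Rightarrow> bool" for C where
  "\<lbrakk>relator C u v; is_path C x (p @ u @ q) y; is_path C x (p @ v @ q) y\<rbrakk>
     \<Longrightarrow> zstep C (x, p @ u @ q, y) (x, p @ v @ q, y)"

definition zrel :: "('o, 'm) cat \<Rightarrow> (('o, 'm) zigzag \<times> ('o, 'm) zigzag) set" where
  "zrel C = {(a, b). a \<in> zigzags C \<and> b \<in> zigzags C \<and> (symclp (zstep C))\<^sup>*\<^sup>* a b}"

definition zclass :: "('o, 'm) cat \<Rightarrow> ('o, 'm) zigzag \<Rightarrow> ('o, 'm) zigzag set" where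
  "zclass C a = zrel C `` {a}"

text \<open>Composition and induced maps are defined as unions over all representatives; all members
  of such a union are the same class, by the lemmas below.\<close>

definition enveloping_groupoid :: "('o, 'm) cat \<Rightarrow> ('o, ('o, 'm) zigzag set) cat" where
  "enveloping_groupoid C =
     \<lparr>Ob = Ob C,
      Mor = zigzags C // zrel C,
      src = (\<lambda>F. THE x. \<exists>w y. (x, w, y) \<in> F),
      tgt = (\<lambda>F. THE y. \<exists>x w. (x, w, y) \<in> F),
      ident = (\<lambda>x. zclass C (x, [], x)),
      cmp = (\<lambda>F G. \<Union>(x, u, y)\<in>F. \<Union>(y', v, z)\<in>G. zclass C (x, u @ v, z))\<rparr>"

definition env_emb :: "('o, 'm) cat \<Rightarrow> 'm \<Rightarrow> ('o, 'm) zigzag set" where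
  "env_emb C f = zclass C (src C f, [Fwd f], tgt C f)"

text \<open>The extension of \<open>\<phi>\<close> to the morphisms of the enveloping groupoid.\<close>

definition env_map ::
  "('o, 'm) cat \<Rightarrow> ('o \<Rightarrow> 'o) \<Rightarrow> ('m \<Rightarrow> 'm) \<Rightarrow> ('o, 'm) zigzag set \<Rightarrow> ('o, 'm) zigzag set" where
  "env_map C \<phi>o \<phi>m F = (\<Union>(x, w, y)\<in>F. zclass C (\<phi>o x, map (map_letter \<phi>m) w, \<phi>o y))"

definition vertex_group :: "('o, 'm) cat \<Rightarrow> 'o \<Rightarrow> 'm monoid" where
  "vertex_group G x =
     \<lparr>carrier = {F \<in> Mor G. src G F = x \<and> tgt G F = x}, monoid.mult = cmp G, one = ident G x\<rparr>"

abbreviation weak_garside_group :: "('o, 'm) cat \<Rightarrow> 'o \<Rightarrow> ('o, 'm) zigzag set monoid" where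
  "weak_garside_group C x \<equiv> vertex_group (enveloping_groupoid C) x"

section \<open>Weak Cayley graphs\<close>

definition mor_from :: "('o, 'm) cat \<Rightarrow> 'o \<Rightarrow> 'm set" where
  "mor_from G x = {F \<in> Mor G. src G F = x}"

definition weak_cayley_graph :: "('o, 'm) cat \<Rightarrow> 'o \<Rightarrow> 'm set \<Rightarrow> ('o, 'm) zigzag set graph" where
  "weak_cayley_graph C x S =
     (let G = enveloping_groupoid C; L = mor_from G x in
      \<lparr>verts = L,
       edges = {(f, g). f \<in> L \<and> g \<in> L \<and> f \<noteq> g \<and>
         (\<exists>s\<in>S. (tgt G g = src C s \<and> f = g \<cdot>\<^bsub>G\<^esub> env_emb C s) \<or>
                (tgt G f = src C s \<and> g = f \<cdot>\<^bsub>G\<^esub> env_emb C s))}\<rparr>)"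

definition garside_automorphism ::
  "('o, 'm) cat \<Rightarrow> ('o \<Rightarrow> 'o) \<Rightarrow> ('m \<Rightarrow> 'm) \<Rightarrow> ('o \<Rightarrow> 'm) \<Rightarrow> 'o
     \<Rightarrow> ('o, 'm) zigzag set \<Rightarrow> ('o, 'm) zigzag set" where
  "garside_automorphism C \<phi>o \<phi>m \<Delta> x f =
     env_emb C (\<Delta> x) \<cdot>\<^bsub>enveloping_groupoid C\<^esub> env_map C \<phi>o \<phi>m f"

definition weak_cayley_quotient ::
  "('o, 'm) cat \<Rightarrow> ('o \<Rightarrow> 'o) \<Rightarrow> ('m \<Rightarrow> 'm) \<Rightarrow> ('o \<Rightarrow> 'm) \<Rightarrow> 'o \<Rightarrow> 'm set
     \<Rightarrow> ('o, 'm) zigzag set set graph" where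
  "weak_cayley_quotient C \<phi>o \<phi>m \<Delta> x S =
     quotient_graph (weak_cayley_graph C x S)
       (cyclic_orbits (mor_from (enveloping_groupoid C) x) (garside_automorphism C \<phi>o \<phi>m \<Delta> x))"


section \<open>Well-definedness\<close>

context small_category
begin

lemma is_path_endpoints: "is_path C x w y \<Longrightarrow> x \<in> Ob C \<and> y \<in> Ob C"
proof (induction w arbitrary: x)
  case (Cons a w)
  then show ?case by (cases a) auto
qed auto

lemma is_path_append: "is_path C x (u @ v) z \<longleftrightarrow> (\<exists>y. is_path C x u y \<and> is_path C y v z)"
proof (induction u arbitrary: x)
  case Nil
  then show ?case using is_path_endpoints by auto
qed auto

lemma zstep_zigzags: "zstep C a b \<Longrightarrow> a \<in> zigzags C \<and> b \<in> zigzags C"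
  by (auto simp: zigzags_def elim!: zstep.cases)

lemma zrel_iff: "(a, b) \<in> zrel C \<longleftrightarrow> a \<in> zigzags C \<and> (symclp (zstep C))\<^sup>*\<^sup>* a b"
proof -
  have "(symclp (zstep C))\<^sup>*\<^sup>* a b \<Longrightarrow> a \<in> zigzags C \<Longrightarrow> b \<in> zigzags C"
    by (induction rule: rtranclp_induct) (auto simp: symclp_def dest: zstep_zigzags)
  then show ?thesis by (auto simp: zrel_def)
qed

lemma equiv_zrel: "equiv (zigzags C) (zrel C)"
proof (rule equivI)
  show "refl_on (zigzags C) (zrel C)"
    by (rule refl_onI) (auto simp: zrel_def)
  show "zrel C \<subseteq> zigzags C \<times> zigzags C" by (auto simp: zrel_def)
  show "sym (zrel C)"
    by (rule symI) (auto simp: zrel_def intro: rtranclp_symclp_sym)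
  show "trans (zrel C)"
    by (rule transI) (auto simp: zrel_def)
qed

lemma zrel_endpoints: "((x, u, y), (x', v, y')) \<in> zrel C \<Longrightarrow> x' = x \<and> y' = y"
proof -
  have "(symclp (zstep C))\<^sup>*\<^sup>* a b \<Longrightarrow> fst b = fst a \<and> snd (snd b) = snd (snd a)" for a b
    by (induction rule: rtranclp_induct) (auto simp: symclp_def elim!: zstep.cases)
  then show "((x, u, y), (x', v, y')) \<in> zrel C \<Longrightarrow> x' = x \<and> y' = y"
    by (fastforce simp: zrel_def)
qed

lemma zrel_is_path: "((x, u, y), (x, v, y)) \<in> zrel C \<Longrightarrow> is_path C x u y \<and> is_path C x v y"
  by (auto simp: zrel_def zigzags_def)

lemma zstep_context:
  assumes "zstep C (x, u, y) (x, v, y)" "is_path C x' p x" "is_path C y q y'"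
  shows "zstep C (x', p @ u @ q, y') (x', p @ v @ q, y')"
proof -
  obtain u' v' p' q' where *: "relator C u' v'" "u = p' @ u' @ q'" "v = p' @ v' @ q'"
    "is_path C x u y" "is_path C x v y"
    using assms(1) by (auto elim: zstep.cases)
  have "is_path C x' ((p @ p') @ u' @ (q' @ q)) y'" "is_path C x' ((p @ p') @ v' @ (q' @ q)) y'"
    using * assms(2,3) by (auto simp: is_path_append)
  from zstep.intros[OF *(1) this] show ?thesis using * by simp
qed

lemma zrel_context:
  assumes "((x, u, y), (x, v, y)) \<in> zrel C" "is_path C x' p x" "is_path C y q y'"
  shows "((x', p @ u @ q, y'), (x', p @ v @ q, y')) \<in> zrel C"
proof -
  have "(symclp (zstep C))\<^sup>*\<^sup>* a b \<Longrightarrow> a = (x, u, y) \<Longrightarrow>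
      (symclp (zstep C))\<^sup>*\<^sup>* (x', p @ u @ q, y') (x', p @ fst (snd b) @ q, y') \<and> fst b = x \<and> snd (snd b) = y"
    for a b
  proof (induction rule: rtranclp_induct)
    case (step b c)
    obtain w where b: "b = (x, w, y)" using step by (metis prod.collapse)
    obtain w' where c: "c = (x, w', y)"
      using step(2) b by (auto simp: symclp_def elim!: zstep.cases)
    have "symclp (zstep C) (x', p @ w @ q, y') (x', p @ w' @ q, y')"
      using step(2) zstep_context[OF _ assms(2,3)] unfolding b c symclp_def by blast
    then show ?case using step b c by auto
  qed auto
  moreover have "is_path C x' (p @ u @ q) y'"
    using zrel_is_path[OF assms(1)] assms(2,3) by (auto simp: is_path_append)
  ultimately show ?thesis using assms(1)
    by (fastforce simp: zrel_iff zigzags_def)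
qed

lemma zrel_append:
  assumes "((x, u, y), (x, u', y)) \<in> zrel C" "((y, v, z), (y, v', z)) \<in> zrel C"
  shows "((x, u @ v, z), (x, u' @ v', z)) \<in> zrel C"
proof -
  have "((x, u @ v, z), (x, u' @ v, z)) \<in> zrel C"
    using zrel_context[OF assms(1), of x "[]" v z] zrel_is_path[OF assms(1)] zrel_is_path[OF assms(2)]
    by (auto dest: is_path_endpoints)
  moreover have "((x, u' @ v, z), (x, u' @ v', z)) \<in> zrel C"
    using zrel_context[OF assms(2), of x "u'" "[]" z] zrel_is_path[OF assms(1)] zrel_is_path[OF assms(2)]
    by (auto dest: is_path_endpoints)
  ultimately show ?thesis using equiv_zrel by (meson equivE transE)
qed

lemma zclass_eq_iff:
  "is_path C x u y \<Longrightarrow> is_path C x v y \<Longrightarrow>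
     zclass C (x, u, y) = zclass C (x, v, y) \<longleftrightarrow> ((x, u, y), (x, v, y)) \<in> zrel C"
  unfolding zclass_def by (rule eq_equiv_class_iff[OF equiv_zrel]) (auto simp: zigzags_def)

lemma mem_zclass: "is_path C x u y \<Longrightarrow> (x, u, y) \<in> zclass C (x, u, y)"
  unfolding zclass_def using equiv_class_self[OF equiv_zrel] by (auto simp: zigzags_def)

lemma mem_zclassE:
  assumes "a \<in> zclass C (x, u, y)"
  obtains v where "a = (x, v, y)" "((x, u, y), (x, v, y)) \<in> zrel C" "is_path C x v y"
proof -
  obtain x' v y' where a: "a = (x', v, y')" by (cases a)
  then have "((x, u, y), (x', v, y')) \<in> zrel C" using assms by (simp add: zclass_def)
  with zrel_endpoints[OF this] zrel_is_path a that show thesis by blast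
qed

lemma zclass_step:
  assumes "relator C u v" "is_path C x (p @ u @ q) y" "is_path C x (p @ v @ q) y"
  shows "zclass C (x, p @ u @ q, y) = zclass C (x, p @ v @ q, y)"
  using zstep.intros[OF assms] assms
  by (subst zclass_eq_iff) (auto simp: zrel_iff zigzags_def)

abbreviation "\<G> \<equiv> enveloping_groupoid C"

lemma Ob_env [simp]: "Ob \<G> = Ob C"
  by (simp add: enveloping_groupoid_def)

lemma zclass_Mor [intro]: "is_path C x w y \<Longrightarrow> zclass C (x, w, y) \<in> Mor \<G>"
  by (auto simp: enveloping_groupoid_def zclass_def zigzags_def intro: quotientI)

lemma env_MorE:
  assumes "F \<in> Mor \<G>"
  obtains x w y where "is_path C x w y" "F = zclass C (x, w, y)"
  using assms by (auto simp: enveloping_groupoid_def zclass_def zigzags_def elim!: quotientE)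

lemma src_zclass [simp]: "is_path C x w y \<Longrightarrow> src \<G> (zclass C (x, w, y)) = x"
  by (auto simp: enveloping_groupoid_def intro!: the_equality elim!: mem_zclassE dest: mem_zclass)

lemma tgt_zclass [simp]: "is_path C x w y \<Longrightarrow> tgt \<G> (zclass C (x, w, y)) = y"
  by (auto simp: enveloping_groupoid_def intro!: the_equality elim!: mem_zclassE dest: mem_zclass)

lemma ident_env: "ident \<G> x = zclass C (x, [], x)"
  by (simp add: enveloping_groupoid_def)

lemma cmp_zclass:
  assumes "is_path C x u y" "is_path C y v z"
  shows "zclass C (x, u, y) \<cdot>\<^bsub>\<G>\<^esub> zclass C (y, v, z) = zclass C (x, u @ v, z)"
proof -
  have *: "zclass C (x, u' @ v', z) = zclass C (x, u @ v, z)"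
    if "((x, u, y), (x, u', y)) \<in> zrel C" "((y, v, z), (y, v', z)) \<in> zrel C" for u' v'
  proof -
    have "((x, u @ v, z), (x, u' @ v', z)) \<in> zrel C"
      using that by (rule zrel_append)
    then show ?thesis using zclass_eq_iff zrel_is_path by blast
  qed
  have inner: "(\<Union>(y', v, z)\<in>zclass C (y, v, z). zclass C (x, u' @ v, z)) = zclass C (x, u @ v, z)"
    if "((x, u, y), (x, u', y)) \<in> zrel C" for u'
  proof -
    have "(case b of (y', v, z) \<Rightarrow> zclass C (x, u' @ v, z)) = zclass C (x, u @ v, z)"
      if "b \<in> zclass C (y, v, z)" for b
      using that by (rule mem_zclassE) (simp add: *[OF \<open>((x, u, y), (x, u', y)) \<in> zrel C\<close>])
    then show ?thesis using mem_zclass[OF assms(2)] by blast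
  qed
  have "(case a of (x', u', t) \<Rightarrow> \<Union>(y', v', z')\<in>zclass C (y, v, z). zclass C (x', u' @ v', z'))
      = zclass C (x, u @ v, z)" if "a \<in> zclass C (x, u, y)" for a
    using that by (rule mem_zclassE) (simp add: inner)
  then have "(\<Union>(x', u', t)\<in>zclass C (x, u, y). \<Union>(y', v', z')\<in>zclass C (y, v, z).
      zclass C (x', u' @ v', z'))
      = zclass C (x, u @ v, z)"
    using mem_zclass[OF assms(1)] by blast
  then show ?thesis by (simp add: enveloping_groupoid_def)
qed

lemma small_category_env: "small_category \<G>"
proof
  fix f assume "f \<in> Mor \<G>"
  then obtain x w y where "is_path C x w y" "f = zclass C (x, w, y)" by (rule env_MorE)
  then show "src \<G> f \<in> Ob \<G>" "tgt \<G> f \<in> Ob \<G>"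
    "ident \<G> (src \<G> f) \<cdot>\<^bsub>\<G>\<^esub> f = f" "f \<cdot>\<^bsub>\<G>\<^esub> ident \<G> (tgt \<G> f) = f"
    using is_path_endpoints by (auto simp: ident_env cmp_zclass)
next
  fix x assume "x \<in> Ob \<G>"
  then show "ident \<G> x \<in> Mor \<G>" "src \<G> (ident \<G> x) = x" "tgt \<G> (ident \<G> x) = x"
    by (auto simp: ident_env)
next
  fix f g assume "f \<in> Mor \<G>" "g \<in> Mor \<G>" "tgt \<G> f = src \<G> g"
  then obtain x u y v z where "is_path C x u y" "f = zclass C (x, u, y)"
    "is_path C y v z" "g = zclass C (y, v, z)"
    by (metis env_MorE src_zclass tgt_zclass)
  then show "f \<cdot>\<^bsub>\<G>\<^esub> g \<in> Mor \<G>" "src \<G> (f \<cdot>\<^bsub>\<G>\<^esub> g) = src \<G> f" "tgt \<G> (f \<cdot>\<^bsub>\<G>\<^esub> g) = tgt \<G> g"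
    using is_path_append[of x u v z] by (auto simp: cmp_zclass)
next
  fix f g h
  assume "f \<in> Mor \<G>" "g \<in> Mor \<G>" "h \<in> Mor \<G>" "tgt \<G> f = src \<G> g" "tgt \<G> g = src \<G> h"
  then obtain x u y v z w t where "is_path C x u y" "f = zclass C (x, u, y)"
    "is_path C y v z" "g = zclass C (y, v, z)" "is_path C z w t" "h = zclass C (z, w, t)"
    by (metis env_MorE src_zclass tgt_zclass)
  moreover from this have "is_path C x (u @ v) z" "is_path C y (v @ w) t"
    by (auto simp: is_path_append)
  ultimately show "f \<cdot>\<^bsub>\<G>\<^esub> g \<cdot>\<^bsub>\<G>\<^esub> h = f \<cdot>\<^bsub>\<G>\<^esub> (g \<cdot>\<^bsub>\<G>\<^esub> h)"
    by (simp add: cmp_zclass)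
qed

primrec flip :: "'x letter \<Rightarrow> 'x letter" where
  "flip (Fwd f) = Bwd f"
| "flip (Bwd f) = Fwd f"

lemma is_path_rev: "is_path C x w y \<Longrightarrow> is_path C y (rev (map flip w)) x"
proof (induction w arbitrary: x)
  case (Cons a w)
  then show ?case by (cases a) (auto simp: is_path_append)
qed auto

lemma zclass_rev: "is_path C x w y \<Longrightarrow> zclass C (x, w @ rev (map flip w), x) = zclass C (x, [], x)"
proof (induction w arbitrary: y rule: rev_induct)
  case (snoc a w)
  obtain z where z: "is_path C x w z" "is_path C z [a] y" using snoc(2) is_path_append by blast
  have rel: "relator C [a, flip a] []" using z(2) by (cases a) (auto intro: relator.intros)
  have p: "is_path C z [a, flip a] z" using z is_path_endpoints by (cases a) auto
  have "zclass C (x, w @ [a, flip a] @ rev (map flip w), x) = zclass C (x, w @ [] @ rev (map flip w), x)"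
  proof (rule zclass_step[OF rel])
    show "is_path C x (w @ [] @ rev (map flip w)) x"
      unfolding is_path_append append_Nil using z(1) is_path_rev[OF z(1)] by blast
    show "is_path C x (w @ [a, flip a] @ rev (map flip w)) x"
      unfolding is_path_append using z(1) p is_path_rev[OF z(1)] by blast
  qed
  then show ?case using snoc.IH[OF z(1)] by simp
qed simp

lemma flip_flip: "rev (map flip (rev (map flip w))) = w"
proof (induction w)
  case (Cons a w)
  then show ?case by (cases a) auto
qed simp

lemma env_inverse:
  assumes "F \<in> Mor \<G>"
  obtains H where "H \<in> Mor \<G>" "src \<G> H = tgt \<G> F" "tgt \<G> H = src \<G> F"
    "F \<cdot>\<^bsub>\<G>\<^esub> H = ident \<G> (src \<G> F)" "H \<cdot>\<^bsub>\<G>\<^esub> F = ident \<G> (tgt \<G> F)"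
proof -
  obtain x w y where F: "is_path C x w y" "F = zclass C (x, w, y)" by (rule env_MorE[OF assms])
  let ?w = "rev (map flip w)"
  have r: "is_path C y ?w x" by (rule is_path_rev[OF F(1)])
  have "zclass C (y, ?w @ w, y) = zclass C (y, [], y)"
    using zclass_rev[OF r] by (simp only: flip_flip)
  then show thesis using F r
    by (intro that[of "zclass C (y, ?w, x)"]) (auto simp: ident_env cmp_zclass zclass_rev)
qed

lemma group_weak_garside_group:
  assumes "x \<in> Ob C"
  shows "group (weak_garside_group C x)"
proof -
  interpret E: small_category \<G> by (rule small_category_env)
  show ?thesis
  proof (rule groupI)
    fix F assume "F \<in> carrier (weak_garside_group C x)"
    then have F: "F \<in> Mor \<G>" "src \<G> F = x" "tgt \<G> F = x" by (auto simp: vertex_group_def)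
    from F(1) obtain H where "H \<in> Mor \<G>" "src \<G> H = tgt \<G> F" "tgt \<G> H = src \<G> F"
      "H \<cdot>\<^bsub>\<G>\<^esub> F = ident \<G> (tgt \<G> F)" by (rule env_inverse)
    then show "\<exists>y\<in>carrier (weak_garside_group C x).
        y \<otimes>\<^bsub>weak_garside_group C x\<^esub> F = \<one>\<^bsub>weak_garside_group C x\<^esub>"
      using F by (auto simp: vertex_group_def)
  qed (use assms E.ident_left in \<open>auto simp: vertex_group_def E.cmp_assoc\<close>)
qed

lemma env_emb_props:
  assumes "f \<in> Mor C"
  shows "env_emb C f \<in> Mor \<G>" "src \<G> (env_emb C f) = src C f" "tgt \<G> (env_emb C f) = tgt C f"
  using assms by (auto simp: env_emb_def)

lemma env_emb_ident: "x \<in> Ob C \<Longrightarrow> env_emb C (ident C x) = ident \<G> x"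
  using zclass_step[of "[Fwd (ident C x)]" "[]" x "[]" "[]" x]
  by (auto simp: env_emb_def ident_env intro: relator.intros)

lemma env_emb_cmp:
  "\<lbrakk>f \<in> Mor C; g \<in> Mor C; tgt C f = src C g\<rbrakk> \<Longrightarrow> env_emb C (f \<cdot> g) = env_emb C f \<cdot>\<^bsub>\<G>\<^esub> env_emb C g"
  using zclass_step[of "[Fwd f, Fwd g]" "[Fwd (f \<cdot> g)]" "src C f" "[]" "[]" "tgt C g"]
  by (auto simp: env_emb_def cmp_zclass intro: relator.intros)

text \<open>For a single object, the weak Cayley graph is the Cayley graph of the group.\<close>

lemma weak_cayley_graph_single:
  assumes "Ob C = {x}" "S \<subseteq> Mor C"
  shows "weak_cayley_graph C x S = cayley_graph (weak_garside_group C x) (env_emb C ` S)"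
proof -
  interpret E: small_category \<G> by (rule small_category_env)
  have 1: "f \<in> Mor \<G> \<Longrightarrow> src \<G> f = x \<and> tgt \<G> f = x" for f
    using E.src_in[of f] E.tgt_in[of f] assms by simp
  have 2: "s \<in> S \<Longrightarrow> src C s = x" for s
    using src_in[of s] assms by auto
  show ?thesis
    by (auto simp: weak_cayley_graph_def cayley_graph_def vertex_group_def mor_from_def Let_def 1 2)
qed

end

context cat_automorphism
begin

abbreviation "\<phi>w \<equiv> map (map_letter \<phi>m)"

lemma is_path_map: "is_path C x w y \<Longrightarrow> is_path C (\<phi>o x) (\<phi>w w) (\<phi>o y)"
proof (induction w arbitrary: x)
  case Nil
  then show ?case using bij_ob by (auto simp: bij_betw_def)
next
  case (Cons a w)
  have "f \<in> Mor C \<Longrightarrow> \<phi>m f \<in> Mor C" for f using bij_mor by (auto simp: bij_betw_def)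
  then show ?case using Cons by (cases a) (auto simp: src_map tgt_map)
qed

lemma relator_map: "relator C u v \<Longrightarrow> relator C (\<phi>w u) (\<phi>w v)"
proof (induction rule: relator.induct)
  case (relator_cmp f g)
  then show ?case using bij_mor
    by (auto simp: map_cmp src_map tgt_map bij_betw_def intro!: relator.relator_cmp)
qed (use bij_mor bij_ob in \<open>auto simp: map_ident bij_betw_def intro!: relator.intros\<close>)

lemma zrel_map:
  assumes "((x, u, y), (x, v, y)) \<in> zrel C"
  shows "((\<phi>o x, \<phi>w u, \<phi>o y), (\<phi>o x, \<phi>w v, \<phi>o y)) \<in> zrel C"
proof -
  let ?h = "\<lambda>(x, w, y). (\<phi>o x, \<phi>w w, \<phi>o y)"
  have *: "zstep C (?h a) (?h b)" if ab: "zstep C a b" for a b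
    using ab
  proof cases
    case (1 u v x p q y)
    from zstep.intros[OF relator_map[OF 1(3)], of "\<phi>o x" "\<phi>w p" "\<phi>w q" "\<phi>o y"] show ?thesis
      using is_path_map[OF 1(4)] is_path_map[OF 1(5)] 1 by simp
  qed
  have "(symclp (zstep C))\<^sup>*\<^sup>* a b \<Longrightarrow> (symclp (zstep C))\<^sup>*\<^sup>* (?h a) (?h b)" for a b
  proof (induction rule: rtranclp_induct)
    case (step b c)
    have "symclp (zstep C) (?h b) (?h c)" using step(2) * unfolding symclp_def by blast
    then show ?case using step by (meson rtranclp.rtrancl_into_rtrancl)
  qed auto
  from this[of "(x, u, y)" "(x, v, y)"] show ?thesis
    using assms is_path_map by (auto simp: zrel_def zigzags_def)
qed

lemma env_map_zclass:
  assumes "is_path C x w y"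
  shows "env_map C \<phi>o \<phi>m (zclass C (x, w, y)) = zclass C (\<phi>o x, \<phi>w w, \<phi>o y)"
proof -
  have *: "zclass C (\<phi>o x, \<phi>w v, \<phi>o y) = zclass C (\<phi>o x, \<phi>w w, \<phi>o y)"
    if "((x, w, y), (x, v, y)) \<in> zrel C" for v
    using zrel_map[OF that] zclass_eq_iff zrel_is_path by metis
  have "(case a of (x, w, y) \<Rightarrow> zclass C (\<phi>o x, \<phi>w w, \<phi>o y)) = zclass C (\<phi>o x, \<phi>w w, \<phi>o y)"
    if "a \<in> zclass C (x, w, y)" for a
    using that by (rule mem_zclassE) (simp add: *)
  then show ?thesis
    unfolding env_map_def using mem_zclass[OF assms] by blast
qed

end

context homogeneous_garside
begin

lemma env_natural:
  assumes "is_path C x w y"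
  shows "zclass C (x, w, y) \<cdot>\<^bsub>\<G>\<^esub> env_emb C (\<Delta> y)
       = env_emb C (\<Delta> x) \<cdot>\<^bsub>\<G>\<^esub> zclass C (\<phi>o x, \<phi>w w, \<phi>o y)"
  using assms
proof (induction w arbitrary: x)
  case Nil
  interpret E: small_category \<G> by (rule small_category_env)
  have "x \<in> Ob C" "y = x" using Nil by auto
  then show ?case
    using E.ident_left[of "env_emb C (\<Delta> x)"] E.ident_right[of "env_emb C (\<Delta> x)"]
    by (simp add: env_emb_props Delta_in src_Delta tgt_Delta ident_env)
next
  case (Cons a w)
  interpret E: small_category \<G> by (rule small_category_env)
  define x' where "x' = letter_tgt C a"
  have a: "is_path C x [a] x'" and w: "is_path C x' w y"
    using Cons.prems is_path_endpoints by (auto simp: x'_def)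
  have ob: "x \<in> Ob C" "x' \<in> Ob C" "y \<in> Ob C" using a w is_path_endpoints by blast+
  let ?A = "zclass C (x, [a], x')" and ?W = "zclass C (x', w, y)"
  let ?A' = "zclass C (\<phi>o x, \<phi>w [a], \<phi>o x')" and ?W' = "zclass C (\<phi>o x', \<phi>w w, \<phi>o y)"
  let ?D = "\<lambda>z. env_emb C (\<Delta> z)"
  have a': "is_path C (\<phi>o x) (\<phi>w [a]) (\<phi>o x')" and w': "is_path C (\<phi>o x') (\<phi>w w) (\<phi>o y)"
    using is_path_map a w by blast+
  have D: "?D z \<in> Mor \<G>" "src \<G> (?D z) = z" "tgt \<G> (?D z) = \<phi>o z" if "z \<in> Ob C" for z
    using that by (auto simp: env_emb_props Delta_in src_Delta tgt_Delta)
  have nat: "env_emb C f \<cdot>\<^bsub>\<G>\<^esub> ?D (tgt C f) = ?D (src C f) \<cdot>\<^bsub>\<G>\<^esub> env_emb C (\<phi>m f)"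
    if "f \<in> Mor C" for f
  proof -
    have "\<phi>m f \<in> Mor C" using bij_mor that by (auto simp: bij_betw_def)
    then show ?thesis using that Delta_natural[OF that]
      by (simp add: env_emb_cmp[symmetric] Delta_in src_Delta tgt_Delta src_map)
  qed
  have A: "?A \<cdot>\<^bsub>\<G>\<^esub> ?D x' = ?D x \<cdot>\<^bsub>\<G>\<^esub> ?A'"
  proof (cases a)
    case (Fwd f)
    then have "f \<in> Mor C" "x = src C f" "x' = tgt C f" using a by auto
    then show ?thesis using nat[of f] by (simp add: Fwd env_emb_def src_map tgt_map)
  next
    case (Bwd f)
    then have f: "f \<in> Mor C" "x = tgt C f" "x' = src C f" using a by auto
    have fm: "\<phi>m f \<in> Mor C" using bij_mor f by (auto simp: bij_betw_def)
    let ?F = "env_emb C f" and ?F' = "env_emb C (\<phi>m f)"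
    have 1: "?A \<cdot>\<^bsub>\<G>\<^esub> ?F = ident \<G> x"
      using zclass_step[of "[Bwd f, Fwd f]" "[]" x "[]" "[]" x] f ob
      by (auto simp: Bwd env_emb_def cmp_zclass ident_env intro: relator.intros)
    have 2: "?F' \<cdot>\<^bsub>\<G>\<^esub> ?A' = ident \<G> (\<phi>o x')"
      using zclass_step[of "[Fwd (\<phi>m f), Bwd (\<phi>m f)]" "[]" "\<phi>o x'" "[]" "[]" "\<phi>o x'"] f fm
      by (auto simp: Bwd env_emb_def cmp_zclass ident_env src_map tgt_map
          simp flip: src_map tgt_map intro: relator.intros)
    note [simp] = f(1) fm env_emb_props D[OF ob(1)] D[OF ob(2)] src_map tgt_map
      f(2,3)[symmetric]
    have [simp]: "?A \<in> Mor \<G>" "?A' \<in> Mor \<G>" "src \<G> ?A = x" "tgt \<G> ?A = x'"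
      "src \<G> ?A' = \<phi>o x" "tgt \<G> ?A' = \<phi>o x'" using a a' by auto
    have "?A \<cdot>\<^bsub>\<G>\<^esub> ?D x' = ?A \<cdot>\<^bsub>\<G>\<^esub> (?D x' \<cdot>\<^bsub>\<G>\<^esub> (?F' \<cdot>\<^bsub>\<G>\<^esub> ?A'))"
      unfolding 2 using E.ident_right[of "?D x'"] by simp
    also have "\<dots> = ?A \<cdot>\<^bsub>\<G>\<^esub> ((?D x' \<cdot>\<^bsub>\<G>\<^esub> ?F') \<cdot>\<^bsub>\<G>\<^esub> ?A')"
      by (subst E.cmp_assoc) (simp_all del: list.map)
    also have "?D x' \<cdot>\<^bsub>\<G>\<^esub> ?F' = ?F \<cdot>\<^bsub>\<G>\<^esub> ?D x"
      using nat[of f] by simp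
    also have "?A \<cdot>\<^bsub>\<G>\<^esub> (?F \<cdot>\<^bsub>\<G>\<^esub> ?D x \<cdot>\<^bsub>\<G>\<^esub> ?A') = (?A \<cdot>\<^bsub>\<G>\<^esub> ?F) \<cdot>\<^bsub>\<G>\<^esub> (?D x \<cdot>\<^bsub>\<G>\<^esub> ?A')"
      by (simp add: E.cmp_assoc del: list.map)
    also have "\<dots> = ?D x \<cdot>\<^bsub>\<G>\<^esub> ?A'"
      unfolding 1 using E.ident_left[of "?D x \<cdot>\<^bsub>\<G>\<^esub> ?A'"] by (simp del: list.map)
    finally show ?thesis .
  qed
  have "zclass C (x, a # w, y) \<cdot>\<^bsub>\<G>\<^esub> ?D y = ?A \<cdot>\<^bsub>\<G>\<^esub> ?W \<cdot>\<^bsub>\<G>\<^esub> ?D y"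
    using cmp_zclass[OF a w] by simp
  also have "\<dots> = ?A \<cdot>\<^bsub>\<G>\<^esub> (?W \<cdot>\<^bsub>\<G>\<^esub> ?D y)"
    using a w ob D by (intro E.cmp_assoc) auto
  also have "\<dots> = ?A \<cdot>\<^bsub>\<G>\<^esub> (?D x' \<cdot>\<^bsub>\<G>\<^esub> ?W')" using Cons.IH[OF w] by simp
  also have "\<dots> = ?A \<cdot>\<^bsub>\<G>\<^esub> ?D x' \<cdot>\<^bsub>\<G>\<^esub> ?W'"
    using a w' ob D by (intro E.cmp_assoc[symmetric]) auto
  also have "\<dots> = ?D x \<cdot>\<^bsub>\<G>\<^esub> ?A' \<cdot>\<^bsub>\<G>\<^esub> ?W'" using A by simp
  also have "\<dots> = ?D x \<cdot>\<^bsub>\<G>\<^esub> (?A' \<cdot>\<^bsub>\<G>\<^esub> ?W')"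
    using a' w' ob D by (intro E.cmp_assoc) auto
  also have "?A' \<cdot>\<^bsub>\<G>\<^esub> ?W' = zclass C (\<phi>o x, \<phi>w (a # w), \<phi>o y)"
    using cmp_zclass[OF a' w'] by simp
  finally show ?case .
qed

lemma garside_automorphism_eq:
  assumes "f \<in> mor_from \<G> x"
  shows "garside_automorphism C \<phi>o \<phi>m \<Delta> x f = f \<cdot>\<^bsub>\<G>\<^esub> env_emb C (\<Delta> (tgt \<G> f))"
proof -
  obtain w y where "is_path C x w y" "f = zclass C (x, w, y)"
    using assms by (auto simp: mor_from_def elim: env_MorE)
  then show ?thesis by (simp add: garside_automorphism_def env_map_zclass env_natural)
qed

lemma bij_garside_automorphism:
  "bij_betw (garside_automorphism C \<phi>o \<phi>m \<Delta> x) (mor_from \<G> x) (mor_from \<G> x)"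
proof -
  interpret E: small_category \<G> by (rule small_category_env)
  let ?D = "\<lambda>z. env_emb C (\<Delta> z)"
  have D [simp]: "?D z \<in> Mor \<G>" "src \<G> (?D z) = z" "tgt \<G> (?D z) = \<phi>o z" if "z \<in> Ob C" for z
    using that by (auto simp: env_emb_props Delta_in src_Delta tgt_Delta)
  have "\<exists>H. H \<in> Mor \<G> \<and> src \<G> H = \<phi>o z \<and> tgt \<G> H = z \<and>
      ?D z \<cdot>\<^bsub>\<G>\<^esub> H = ident \<G> z \<and> H \<cdot>\<^bsub>\<G>\<^esub> ?D z = ident \<G> (\<phi>o z)" if "z \<in> Ob C" for z
    by (rule env_inverse[of "?D z"]) (use that in auto)
  then obtain I where I: "\<And>z. z \<in> Ob C \<Longrightarrow> I z \<in> Mor \<G> \<and> src \<G> (I z) = \<phi>o z \<and> tgt \<G> (I z) = z \<and>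
      ?D z \<cdot>\<^bsub>\<G>\<^esub> I z = ident \<G> z \<and> I z \<cdot>\<^bsub>\<G>\<^esub> ?D z = ident \<G> (\<phi>o z)"
    by metis
  define \<psi> where "\<psi> = inv_into (Ob C) \<phi>o"
  have \<psi>: "\<psi> z \<in> Ob C" "\<phi>o (\<psi> z) = z" if "z \<in> Ob C" for z
    using that bij_ob unfolding \<psi>_def by (metis bij_betw_def inv_into_into f_inv_into_f)+
  have \<psi>': "\<psi> (\<phi>o z) = z" if "z \<in> Ob C" for z
    using that bij_ob unfolding \<psi>_def by (simp add: bij_betw_def)
  have m: "f \<in> mor_from \<G> x \<Longrightarrow> f \<in> Mor \<G> \<and> src \<G> f = x \<and> tgt \<G> f \<in> Ob C" for f
    using E.tgt_in[of f] by (auto simp: mor_from_def)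
  show ?thesis
  proof (rule bij_betw_byWitness[where f' = "\<lambda>g. g \<cdot>\<^bsub>\<G>\<^esub> I (\<psi> (tgt \<G> g))"])
    show "\<forall>f\<in>mor_from \<G> x. garside_automorphism C \<phi>o \<phi>m \<Delta> x f \<cdot>\<^bsub>\<G>\<^esub>
        I (\<psi> (tgt \<G> (garside_automorphism C \<phi>o \<phi>m \<Delta> x f))) = f"
    proof
      fix f assume f: "f \<in> mor_from \<G> x"
      note mf = m[OF f]
      then have "f \<cdot>\<^bsub>\<G>\<^esub> ?D (tgt \<G> f) \<cdot>\<^bsub>\<G>\<^esub> I (tgt \<G> f) = f \<cdot>\<^bsub>\<G>\<^esub> (?D (tgt \<G> f) \<cdot>\<^bsub>\<G>\<^esub> I (tgt \<G> f))"
        using I by (intro E.cmp_assoc) auto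
      then show "garside_automorphism C \<phi>o \<phi>m \<Delta> x f \<cdot>\<^bsub>\<G>\<^esub>
          I (\<psi> (tgt \<G> (garside_automorphism C \<phi>o \<phi>m \<Delta> x f))) = f"
        using mf I[of "tgt \<G> f"] f by (simp add: garside_automorphism_eq \<psi>')
    qed
    have J: "g \<cdot>\<^bsub>\<G>\<^esub> I (\<psi> (tgt \<G> g)) \<in> mor_from \<G> x \<and> tgt \<G> (g \<cdot>\<^bsub>\<G>\<^esub> I (\<psi> (tgt \<G> g))) = \<psi> (tgt \<G> g)"
      if "g \<in> mor_from \<G> x" for g
      using m[OF that] I[of "\<psi> (tgt \<G> g)"] \<psi>[of "tgt \<G> g"] by (simp add: mor_from_def)
    show "\<forall>g\<in>mor_from \<G> x. garside_automorphism C \<phi>o \<phi>m \<Delta> x (g \<cdot>\<^bsub>\<G>\<^esub> I (\<psi> (tgt \<G> g))) = g"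
    proof
      fix g assume g: "g \<in> mor_from \<G> x"
      let ?z = "\<psi> (tgt \<G> g)"
      have z: "?z \<in> Ob C" "\<phi>o ?z = tgt \<G> g" using \<psi> m[OF g] by auto
      have "g \<cdot>\<^bsub>\<G>\<^esub> I ?z \<cdot>\<^bsub>\<G>\<^esub> ?D ?z = g \<cdot>\<^bsub>\<G>\<^esub> (I ?z \<cdot>\<^bsub>\<G>\<^esub> ?D ?z)"
        using m[OF g] I[OF z(1)] z by (intro E.cmp_assoc) auto
      then show "garside_automorphism C \<phi>o \<phi>m \<Delta> x (g \<cdot>\<^bsub>\<G>\<^esub> I ?z) = g"
        using J[OF g] I[OF z(1)] z m[OF g] by (simp add: garside_automorphism_eq)
    qed
    show "garside_automorphism C \<phi>o \<phi>m \<Delta> x ` mor_from \<G> x \<subseteq> mor_from \<G> x"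
      using m by (auto simp: garside_automorphism_eq mor_from_def)
    show "(\<lambda>g. g \<cdot>\<^bsub>\<G>\<^esub> I (\<psi> (tgt \<G> g))) ` mor_from \<G> x \<subseteq> mor_from \<G> x"
      using J by auto
  qed
qed

end

end

(* Right multiplication by Garside elements is an automorphism sigma of the set L of morphisms with
   source x, ordered by left divisibility, and u is adjacent or equal to v if and only if
   u <= v <= sigma u or v <= u <= sigma v. The poset L has joins: any two of its elements have a
   common lower bound, above which L looks like a piece of the category, because the category
   embeds into its groupoid. In the Cayley graph, d(x, y) is the least a + b with
   y <= sigma^a x and x <= sigma^b y; in the quotient it is the least n with u <= v <= sigma^n u for
   some representatives u and v. In either graph each vertex asked for by the triangle and
   quadrangle conditions only has to lie above finitely many elements and below finitely many
   others, all of the former being below all of the latter; the join of the former is such a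
   vertex. *)

theory Submission
  imports Defs
begin

section \<open>Weak modularity in terms of balls\<close>

text \<open>The order controls distances because \<open>y \<sqsubseteq> s a x\<close> and
  \<open>x \<sqsubseteq> s b y\<close> are separate conditions, so bounds taken from two different
  paths may be mixed. At exact distance \<open>a + b\<close> this determines the pair
  \<open>(a, b)\<close>, the type of \<open>y\<close> as seen from \<open>x\<close>, and leaves few
  ways for the type to change along an edge. In the quotient a downward step is an upward one up to
  a shift, so types disappear; the work there lies in choosing representatives whose exponents
  match. Common lower bounds exist because homogeneity breaks every morphism of the category into
  atoms, and each atom divides a Garside element: a power of the shift compensates any formal
  inverse. The embedding of the category is the point where the presentation of the groupoid by
  zigzags has to be controlled. A zigzag is made to act as a partial map on morphisms; rewriting
  alters the domain of this map, so only its values can serve as an invariant.\<close>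

lemma gdist_le_iff: "gdist \<Gamma> u v \<le> enat n \<longleftrightarrow> (\<exists>m\<le>n. (u, v) \<in> edges \<Gamma> ^^ m)"
proof
  assume *: "gdist \<Gamma> u v \<le> enat n"
  let ?K = "enat ` {k. (u, v) \<in> edges \<Gamma> ^^ k}"
  have "?K \<noteq> {}"
    using * unfolding gdist_def by (intro notI) (simp add: top_enat_def)
  then have "Inf ?K \<in> ?K" by (auto intro!: wellorder_InfI)
  then show "\<exists>m\<le>n. (u, v) \<in> edges \<Gamma> ^^ m"
    using * unfolding gdist_def by auto
next
  assume "\<exists>m\<le>n. (u, v) \<in> edges \<Gamma> ^^ m"
  then obtain m where "m \<le> n" "(u, v) \<in> edges \<Gamma> ^^ m" by blast
  then show "gdist \<Gamma> u v \<le> enat n"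
    unfolding gdist_def by (intro INF_lower2[of m]) auto
qed

lemma gdist_sym:
  assumes "sym (edges \<Gamma>)"
  shows "gdist \<Gamma> u v = gdist \<Gamma> v u"
proof -
  have "converse (edges \<Gamma> ^^ k) = edges \<Gamma> ^^ k" for k
  proof (induction k)
    case (Suc k)
    then show ?case
      using assms by (simp add: converse_relcomp sym_conv_converse_eq flip: relpow_commute)
  qed auto
  then have "(u, v) \<in> edges \<Gamma> ^^ k \<longleftrightarrow> (v, u) \<in> edges \<Gamma> ^^ k" for k
    by (metis converse_iff)
  then show ?thesis by (simp add: gdist_def)
qed

lemma gdist_eq_Suc_iff:
  "gdist \<Gamma> u v = enat (Suc n) \<longleftrightarrow> gdist \<Gamma> u v \<le> enat (Suc n) \<and> \<not> gdist \<Gamma> u v \<le> enat n"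
  by (cases "gdist \<Gamma> u v") auto

text \<open>\<open>A\<close> is adjacency or equality, and \<open>B n x\<close> is the ball of radius \<open>n\<close> about \<open>x\<close>.\<close>

locale ball_system =
  fixes V :: "'v set" and A :: "'v \<Rightarrow> 'v \<Rightarrow> bool" and B :: "nat \<Rightarrow> 'v \<Rightarrow> 'v \<Rightarrow> bool"
  assumes A_refl: "u \<in> V \<Longrightarrow> A u u"
    and A_sym: "\<lbrakk>u \<in> V; v \<in> V; A u v\<rbrakk> \<Longrightarrow> A v u"
    and ball_0: "\<lbrakk>u \<in> V; v \<in> V\<rbrakk> \<Longrightarrow> B 0 u v \<longleftrightarrow> u = v"
    and ball_Suc: "\<lbrakk>u \<in> V; v \<in> V\<rbrakk> \<Longrightarrow> B (Suc n) u v \<longleftrightarrow> (\<exists>w\<in>V. B n u w \<and> A w v)"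
begin

abbreviation \<Gamma> :: "'v graph" where
  "\<Gamma> \<equiv> \<lparr>verts = V, edges = {(u, v). u \<in> V \<and> v \<in> V \<and> u \<noteq> v \<and> A u v}\<rparr>"

lemma simplicial: "simplicial_graph \<Gamma>"
  using A_sym by (auto simp: simplicial_graph_def sym_def irrefl_def)

lemma gdist_le_iff_ball:
  assumes "u \<in> V" "v \<in> V"
  shows "gdist \<Gamma> u v \<le> enat n \<longleftrightarrow> B n u v"
  using assms(2)
proof (induction n arbitrary: v)
  case 0
  then show ?case using assms(1) by (auto simp: gdist_le_iff ball_0)
next
  case (Suc n)
  have "(\<exists>m\<le>Suc n. (u, v) \<in> edges \<Gamma> ^^ m) \<longleftrightarrow>
      (\<exists>w\<in>V. (\<exists>m\<le>n. (u, w) \<in> edges \<Gamma> ^^ m) \<and> A w v)" (is "?l \<longleftrightarrow> ?r")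
  proof
    assume ?l
    then obtain m where m: "m \<le> Suc n" "(u, v) \<in> edges \<Gamma> ^^ m" by blast
    show ?r
    proof (cases m)
      case 0
      then show ?thesis using m A_refl Suc.prems by (intro bexI[of _ v]) auto
    next
      case (Suc k)
      then obtain w where "(u, w) \<in> edges \<Gamma> ^^ k" "(w, v) \<in> edges \<Gamma>" using m by auto
      then show ?thesis using m Suc by (intro bexI[of _ w]) auto
    qed
  next
    assume ?r
    then obtain w m where w: "w \<in> V" "m \<le> n" "(u, w) \<in> edges \<Gamma> ^^ m" "A w v" by blast
    show ?l
    proof (cases "w = v")
      case True
      then show ?thesis using w le_SucI by blast
    next
      case False
      then have "(u, v) \<in> edges \<Gamma> ^^ Suc m" using w Suc.prems by auto
      then show ?thesis using w by blast
    qed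
  qed
  then have "gdist \<Gamma> u v \<le> enat (Suc n) \<longleftrightarrow> (\<exists>w\<in>V. gdist \<Gamma> u w \<le> enat n \<and> A w v)"
    by (simp only: gdist_le_iff)
  then show ?case
    using Suc assms(1) ball_Suc by simp
qed

text \<open>Upper bounds on the distances of \<open>w\<close> suffice. Since \<open>y\<close> and
  \<open>z\<close> lie outside the ball of radius \<open>n\<close> about \<open>x\<close>,
  \<open>w\<close> equals neither of them, and for positive \<open>n\<close> a vertex
  \<open>w\<close> at distance less than \<open>n\<close> would bring \<open>y\<close> into that
  ball. So all three distances are exact.\<close>

lemma weakly_modularI:
  assumes tri: "\<And>n x y z. \<lbrakk>x \<in> V; y \<in> V; z \<in> V; A y z; B (Suc n) x y; B (Suc n) x z;
      \<not> B n x y; \<not> B n x z\<rbrakk> \<Longrightarrow> \<exists>w\<in>V. B n x w \<and> A w y \<and> A w z"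
    and quad: "\<And>n x y z t. \<lbrakk>x \<in> V; y \<in> V; z \<in> V; t \<in> V; A y t; A z t;
      B (Suc n) x y; B (Suc n) x z; B (Suc (Suc n)) x t;
      \<not> B n x y; \<not> B n x z; \<not> B (Suc n) x t\<rbrakk> \<Longrightarrow> \<exists>w\<in>V. B n x w \<and> A w y \<and> A w z"
  shows "weakly_modular \<Gamma>"
proof -
  have gd_sym: "gdist \<Gamma> u v = gdist \<Gamma> v u" for u v
    using simplicial by (intro gdist_sym) (simp add: simplicial_graph_def)
  have conv: "gdist \<Gamma> u v = enat (Suc n) \<longleftrightarrow> B (Suc n) u v \<and> \<not> B n u v"
    if "u \<in> V" "v \<in> V" for u v n
    using that gdist_le_iff_ball by (simp add: gdist_eq_Suc_iff)
  have near: "gdist \<Gamma> w y = 1" if "w \<in> V" "y \<in> V" "A w y" "w \<noteq> y" for w y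
    using that conv[of w y 0] by (auto simp: one_enat_def ball_0 ball_Suc)
  have concl: "\<exists>w\<in>V. gdist \<Gamma> w x = enat n \<and> gdist \<Gamma> w y = 1 \<and> gdist \<Gamma> w z = 1"
    if V: "x \<in> V" "y \<in> V" "z \<in> V" and y: "\<not> B n x y" and z: "\<not> B n x z"
      and ex: "\<exists>w\<in>V. B n x w \<and> A w y \<and> A w z" for x y z n
  proof -
    obtain w where w: "w \<in> V" "B n x w" "A w y" "A w z" using ex by blast
    have "gdist \<Gamma> x w = enat n"
    proof (cases n)
      case 0
      then show ?thesis using gdist_le_iff_ball[of x w 0] w V by (auto simp: enat_0)
    next
      case (Suc k)
      have "\<not> B k x w" using y ball_Suc[OF V(1,2), of k] w Suc by blast
      then show ?thesis using conv[of x w k] w V Suc by simp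
    qed
    moreover have "w \<noteq> y" "w \<noteq> z" using w y z by auto
    ultimately show ?thesis
      using w near V gd_sym[of w x] by (intro bexI[of _ w]) auto
  qed
  show ?thesis unfolding weakly_modular_def
  proof (intro conjI simplicial ballI allI impI)
    fix x and n :: nat assume x: "x \<in> verts \<Gamma>" and "2 \<le> n"
    then obtain m where n: "n = Suc m" using not0_implies_Suc by fastforce
    show "triangle_condition \<Gamma> x n"
      unfolding triangle_condition_def n
      using x concl[of x _ _ m] tri[of x _ _ m] conv[of x _ m] by simp
    show "quadrangle_condition \<Gamma> x n"
      unfolding quadrangle_condition_def n
    proof (intro ballI impI, elim conjE bexE)
      fix y z t
      assume "y \<in> verts \<Gamma>" "z \<in> verts \<Gamma>" "t \<in> verts \<Gamma>" "(y, t) \<in> edges \<Gamma>" "(z, t) \<in> edges \<Gamma>"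
        "gdist \<Gamma> x y = enat (Suc m)" "gdist \<Gamma> x z = enat (Suc m)"
        "gdist \<Gamma> x t = enat (Suc m + 1)"
      then show "\<exists>w\<in>verts \<Gamma>. gdist \<Gamma> w x = enat (Suc m - 1) \<and> gdist \<Gamma> w y = 1 \<and> gdist \<Gamma> w z = 1"
        using x concl[of x y z m] quad[of x y z t m] by (simp add: conv)
    qed
  qed
qed

end

section \<open>Orders with a shift automorphism\<close>

text \<open>The shift \<open>s\<close> is an action of the integers, and \<open>s 1\<close> plays the role of right
  multiplication by the Garside element.\<close>

locale shifted_order =
  fixes V :: "'a set" and le :: "'a \<Rightarrow> 'a \<Rightarrow> bool" (infix \<open>\<sqsubseteq>\<close> 50) and s :: "int \<Rightarrow> 'a \<Rightarrow> 'a"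
  assumes le_refl [simp]: "u \<in> V \<Longrightarrow> u \<sqsubseteq> u"
    and le_antisym: "\<lbrakk>u \<in> V; v \<in> V; u \<sqsubseteq> v; v \<sqsubseteq> u\<rbrakk> \<Longrightarrow> u = v"
    and le_trans: "\<lbrakk>u \<sqsubseteq> v; v \<sqsubseteq> w; u \<in> V; v \<in> V; w \<in> V\<rbrakk> \<Longrightarrow> u \<sqsubseteq> w"
    and s_in [simp]: "u \<in> V \<Longrightarrow> s i u \<in> V"
    and s_0 [simp]: "u \<in> V \<Longrightarrow> s 0 u = u"
    and s_s [simp]: "u \<in> V \<Longrightarrow> s i (s j u) = s (i + j) u"
    and s_1_iff: "\<lbrakk>u \<in> V; v \<in> V\<rbrakk> \<Longrightarrow> s 1 u \<sqsubseteq> s 1 v \<longleftrightarrow> u \<sqsubseteq> v"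
    and le_s_1: "u \<in> V \<Longrightarrow> u \<sqsubseteq> s 1 u"
begin

lemma s_iff:
  assumes V: "u \<in> V" "v \<in> V"
  shows "s i u \<sqsubseteq> s i v \<longleftrightarrow> u \<sqsubseteq> v"
proof (induction i rule: int_induct[of _ 0])
  case (step1 i)
  then show ?case using s_1_iff[of "s i u" "s i v"] V by (simp add: add.commute)
next
  case (step2 i)
  then show ?case using s_1_iff[of "s (i - 1) u" "s (i - 1) v"] V by simp
qed (use V in simp)

lemma shift_iff:
  assumes "u \<in> V" "v \<in> V"
  shows "s i u \<sqsubseteq> s j v \<longleftrightarrow> u \<sqsubseteq> s (j - i) v"
  using s_iff[of u "s (j - i) v" i] assms by simp

lemma shift_left_iff: "\<lbrakk>u \<in> V; v \<in> V\<rbrakk> \<Longrightarrow> s i u \<sqsubseteq> v \<longleftrightarrow> u \<sqsubseteq> s (- i) v"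
  using shift_iff[of u v i 0] by simp

lemma le_shift:
  assumes u: "u \<in> V" and "0 \<le> i"
  shows "u \<sqsubseteq> s i u"
  using \<open>0 \<le> i\<close>
proof (induction i rule: int_ge_induct)
  case (step i)
  have "s i u \<sqsubseteq> s (i + 1) u" using u le_s_1 by (simp add: shift_iff)
  with step.IH show ?case by (rule le_trans) (use u in simp_all)
qed (use u in simp)

lemma s_le: "\<lbrakk>u \<in> V; i \<le> j\<rbrakk> \<Longrightarrow> s i u \<sqsubseteq> s j u"
  by (simp add: shift_iff le_shift)

lemma le_shift_trans:
  assumes "u \<sqsubseteq> s i v" "v \<sqsubseteq> s j w" "i + j \<le> k" "u \<in> V" "v \<in> V" "w \<in> V"
  shows "u \<sqsubseteq> s k w"
proof -
  have "s i v \<sqsubseteq> s (i + j) w"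
    using assms by (simp add: shift_iff)
  then have "s i v \<sqsubseteq> s k w"
    by (rule le_trans) (use assms s_le in simp_all)
  with \<open>u \<sqsubseteq> s i v\<close> show ?thesis by (rule le_trans) (use assms in simp_all)
qed

end

section \<open>Distances and weak modularity in the graph of a shifted join-semilattice\<close>

locale shifted_join_semilattice = shifted_order +
  assumes join_exists: "\<lbrakk>u \<in> V; v \<in> V\<rbrakk> \<Longrightarrow>
      \<exists>w\<in>V. u \<sqsubseteq> w \<and> v \<sqsubseteq> w \<and> (\<forall>t\<in>V. u \<sqsubseteq> t \<longrightarrow> v \<sqsubseteq> t \<longrightarrow> w \<sqsubseteq> t)"
begin

text \<open>Two binary joins give the ternary one. Where only two lower bounds occur, one of them is
  repeated.\<close>

lemma interpolate:
  assumes V: "p \<in> V" "q \<in> V" "r \<in> V"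
    and le: "\<forall>t\<in>U. t \<in> V \<and> p \<sqsubseteq> t \<and> q \<sqsubseteq> t \<and> r \<sqsubseteq> t"
  shows "\<exists>w\<in>V. p \<sqsubseteq> w \<and> q \<sqsubseteq> w \<and> r \<sqsubseteq> w \<and> (\<forall>t\<in>U. w \<sqsubseteq> t)"
proof -
  obtain v where v: "v \<in> V" "p \<sqsubseteq> v" "q \<sqsubseteq> v" "\<forall>t\<in>V. p \<sqsubseteq> t \<longrightarrow> q \<sqsubseteq> t \<longrightarrow> v \<sqsubseteq> t"
    using join_exists[OF V(1,2)] by blast
  obtain w where w: "w \<in> V" "v \<sqsubseteq> w" "r \<sqsubseteq> w" "\<forall>t\<in>V. v \<sqsubseteq> t \<longrightarrow> r \<sqsubseteq> t \<longrightarrow> w \<sqsubseteq> t"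
    using join_exists[OF v(1) V(3)] by blast
  have "p \<sqsubseteq> w" "q \<sqsubseteq> w"
    using le_trans[OF v(2) w(2)] le_trans[OF v(3) w(2)] V v w by simp_all
  then show ?thesis using v w le by blast
qed

definition close :: "'a \<Rightarrow> 'a \<Rightarrow> bool" where
  "close u v \<longleftrightarrow> u \<sqsubseteq> v \<and> v \<sqsubseteq> s 1 u \<or> v \<sqsubseteq> u \<and> u \<sqsubseteq> s 1 v"

text \<open>The pairs joined by a path with at most \<open>a\<close> upward and \<open>b\<close> downward steps.\<close>

definition reach :: "nat \<Rightarrow> nat \<Rightarrow> 'a \<Rightarrow> 'a \<Rightarrow> bool" where
  "reach a b x y \<longleftrightarrow> y \<sqsubseteq> s (int a) x \<and> x \<sqsubseteq> s (int b) y"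

definition ball :: "nat \<Rightarrow> 'a \<Rightarrow> 'a \<Rightarrow> bool" where
  "ball n x y \<longleftrightarrow> (\<exists>a b. a + b = n \<and> reach a b x y)"

lemma reach_le_trans:
  assumes "y \<sqsubseteq> s (int a) x" "x \<sqsubseteq> s (int b) y" "z \<sqsubseteq> s i y" "y \<sqsubseteq> s j z"
    and "int a + i \<le> int a'" "int b + j \<le> int b'" and V: "x \<in> V" "y \<in> V" "z \<in> V"
  shows "reach a' b' x z"
  unfolding reach_def
  using le_shift_trans[OF assms(3,1)] le_shift_trans[OF assms(2,4)] assms by (simp add: add.commute)

lemma ball_if_reach:
  assumes "reach a b x y" "a + b \<le> n" "x \<in> V" "y \<in> V"
  shows "ball n x y"
proof -
  have "reach a (n - a) x y"
    using assms reach_le_trans[of y a x b y 0 0 a "n - a"] by (simp add: reach_def)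
  then show ?thesis
    using assms(2) unfolding ball_def by (intro exI[of _ a] exI[of _ "n - a"]) simp
qed

text \<open>When a path is to be found, its last step can be taken upwards if \<open>a > 0\<close>
  and is downwards if \<open>a = 0\<close>. The conditions on the last but one vertex are then
  solved for that vertex, each becoming a lower or an upper bound.\<close>

lemma ball_Suc_iff:
  assumes V: "x \<in> V" "y \<in> V"
  shows "ball (Suc n) x y \<longleftrightarrow> (\<exists>z\<in>V. ball n x z \<and> close z y)"
proof
  assume "\<exists>z\<in>V. ball n x z \<and> close z y"
  then obtain z a b where z: "z \<in> V" "close z y" "a + b = n" "reach a b x z"
    unfolding ball_def by blast
  then have "reach (Suc a) b x y \<or> reach a (Suc b) x y"
    using V reach_le_trans[of z a x b y 1 0 "Suc a" b] reach_le_trans[of z a x b y 0 1 a "Suc b"]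
    by (auto simp: close_def reach_def)
  then show "ball (Suc n) x y"
    using z V by (auto intro: ball_if_reach)
next
  assume "ball (Suc n) x y"
  then obtain a b where ab: "a + b = Suc n" "y \<sqsubseteq> s (int a) x" "x \<sqsubseteq> s (int b) y"
    unfolding ball_def reach_def by blast
  show "\<exists>z\<in>V. ball n x z \<and> close z y"
  proof (cases a)
    case (Suc k)
    \<comment> \<open>A step up from \<open>z\<close> to \<open>y\<close> asks for
      \<open>?p \<sqsubseteq> z \<sqsubseteq> y\<close>, and \<open>reach k b x z\<close> for
      \<open>?q \<sqsubseteq> z \<sqsubseteq> ?q'\<close>.\<close>
    let ?p = "s (- 1) y" and ?q = "s (- int b) x" and ?q' = "s (int k) x"
    have "?p \<sqsubseteq> y" "?p \<sqsubseteq> ?q'" "?q \<sqsubseteq> y" "?q \<sqsubseteq> ?q'"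
      using ab V by (auto simp: shift_iff shift_left_iff le_shift Suc add.commute)
    then obtain z where z: "z \<in> V" "?p \<sqsubseteq> z" "?q \<sqsubseteq> z" "z \<sqsubseteq> y" "z \<sqsubseteq> ?q'"
      using interpolate[of ?p ?q ?q "{y, ?q'}"] V by auto
    then have "reach k b x z" "close z y"
      using V by (auto simp: reach_def close_def shift_left_iff)
    then show ?thesis using z(1) ab Suc by (auto simp: ball_def)
  next
    case 0
    then obtain k where k: "b = Suc k" using ab by simp
    let ?q = "s (- int k) x" and ?q' = "s 1 y"
    have "y \<sqsubseteq> x" "y \<sqsubseteq> ?q'" "?q \<sqsubseteq> x" "?q \<sqsubseteq> ?q'"
      using ab V 0 by (auto simp: shift_iff shift_left_iff le_shift k add.commute)
    then obtain z where z: "z \<in> V" "y \<sqsubseteq> z" "?q \<sqsubseteq> z" "z \<sqsubseteq> x" "z \<sqsubseteq> ?q'"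
      using interpolate[of y ?q ?q "{x, ?q'}"] V by auto
    then have "reach 0 k x z" "close z y"
      using V by (auto simp: reach_def close_def shift_left_iff)
    then show ?thesis using z(1) V ab 0 k ball_if_reach[of 0 k x z n] by auto
  qed
qed

sublocale ball_system V close ball
proof
  fix u v assume "u \<in> V" "v \<in> V"
  then show "ball 0 u v \<longleftrightarrow> u = v"
    using le_antisym by (auto simp: ball_def reach_def)
next
  fix u v n assume "u \<in> V" "v \<in> V"
  then show "ball (Suc n) u v \<longleftrightarrow> (\<exists>w\<in>V. ball n u w \<and> close w v)"
    by (rule ball_Suc_iff)
qed (auto simp: close_def le_shift)

text \<open>If the common type has an upward step, \<open>y\<close> and \<open>z\<close> can both be
  entered upwards, from a vertex below both; if it has none, both are entered downwards, from a
  vertex above both. The bounds \<open>yz\<close> are what makes the one-step translate of either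
  point comparable with the other point.\<close>

lemma common_neighbour_same_type:
  assumes y: "reach a b x y" and z: "reach a b x z" and n: "a + b = Suc n"
    and yz: "y \<sqsubseteq> s 1 z" "z \<sqsubseteq> s 1 y" and V: "x \<in> V" "y \<in> V" "z \<in> V"
  shows "\<exists>w\<in>V. ball n x w \<and> close w y \<and> close w z"
proof (cases a)
  case (Suc k)
  let ?p = "s (- 1) y" and ?q = "s (- 1) z" and ?r = "s (- int b) x" and ?t = "s (int k) x"
  have "\<forall>t\<in>{y, z, ?t}. t \<in> V \<and> ?p \<sqsubseteq> t \<and> ?q \<sqsubseteq> t \<and> ?r \<sqsubseteq> t"
    using y z yz V by (auto simp: reach_def shift_iff shift_left_iff le_shift Suc add.commute)
  then obtain w where w: "w \<in> V" "?p \<sqsubseteq> w" "?q \<sqsubseteq> w" "?r \<sqsubseteq> w" "w \<sqsubseteq> y" "w \<sqsubseteq> z" "w \<sqsubseteq> ?t"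
    using interpolate[of ?p ?q ?r "{y, z, ?t}"] V by auto
  then have "reach k b x w" "close w y" "close w z"
    using V by (auto simp: reach_def close_def shift_left_iff)
  then show ?thesis using w(1) n Suc by (auto simp: ball_def)
next
  case 0
  then have b: "b = Suc n" using n by simp
  let ?r = "s (- int n) x" and ?y = "s 1 y" and ?z = "s 1 z"
  have "\<forall>t\<in>{?y, ?z, x}. t \<in> V \<and> y \<sqsubseteq> t \<and> z \<sqsubseteq> t \<and> ?r \<sqsubseteq> t"
    using y z yz V 0 by (auto simp: reach_def shift_iff shift_left_iff le_shift b add.commute)
  then obtain w where w: "w \<in> V" "y \<sqsubseteq> w" "z \<sqsubseteq> w" "?r \<sqsubseteq> w" "w \<sqsubseteq> ?y" "w \<sqsubseteq> ?z" "w \<sqsubseteq> x"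
    using interpolate[of y z ?r "{?y, ?z, x}"] V by auto
  then have "reach 0 n x w" "close w y" "close w z"
    using V by (auto simp: reach_def close_def shift_left_iff)
  then show ?thesis using w(1) V ball_if_reach[of 0 n x w n] by auto
qed

text \<open>Here \<open>w\<close> is sought between \<open>y\<close> and \<open>z\<close>, one step
  above \<open>y\<close> and one step below \<open>z\<close>. The shift by 2 is the room for these
  two steps: it says that \<open>s (- 1) z\<close> lies below \<open>s 1 y\<close>.\<close>

lemma common_neighbour_mixed_type:
  assumes y: "reach a (Suc b) x y" and z: "reach (Suc a) b x z"
    and yz: "y \<sqsubseteq> z" "z \<sqsubseteq> s 2 y" and V: "x \<in> V" "y \<in> V" "z \<in> V"
  shows "\<exists>w\<in>V. ball (a + b) x w \<and> close w y \<and> close w z"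
proof -
  let ?q = "s (- 1) z" and ?r = "s (- int b) x" and ?y = "s 1 y" and ?t = "s (int a) x"
  have "\<forall>t\<in>{z, ?y, ?t}. t \<in> V \<and> y \<sqsubseteq> t \<and> ?q \<sqsubseteq> t \<and> ?r \<sqsubseteq> t"
    using y z yz V by (auto simp: reach_def shift_iff shift_left_iff le_shift add.commute)
  then obtain w where w: "w \<in> V" "y \<sqsubseteq> w" "?q \<sqsubseteq> w" "?r \<sqsubseteq> w" "w \<sqsubseteq> z" "w \<sqsubseteq> ?y" "w \<sqsubseteq> ?t"
    using interpolate[of y ?q ?r "{z, ?y, ?t}"] V by auto
  then have "reach a b x w" "close w y" "close w z"
    using V by (auto simp: reach_def close_def shift_left_iff)
  then show ?thesis using w(1) by (auto simp: ball_def)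
qed

text \<open>The bounds for \<open>t\<close> and those obtained through \<open>y\<close> can be
  mixed, so that both \<open>(Suc c, b)\<close> and \<open>(a, d)\<close> reach \<open>t\<close>.
  Each sum must exceed \<open>n\<close>, while together they give \<open>2 n + 2\<close>; hence both
  equal \<open>Suc n\<close>, and \<open>y\<close> has the type of \<open>t\<close> with one upward
  step removed.\<close>

lemma reach_predecessor:
  assumes t: "reach a b x t" "a + b = Suc n" "\<not> ball n x t" and y: "ball n x y"
    and yt: "y \<sqsubseteq> t" "t \<sqsubseteq> s 1 y" and V: "x \<in> V" "y \<in> V" "t \<in> V"
  shows "\<exists>k. a = Suc k \<and> reach k b x y"
proof -
  obtain c d where cd: "c + d = n" "reach c d x y" using y by (auto simp: ball_def)
  have "reach (Suc c) b x t"
    using cd t yt V reach_le_trans[of y c x d t 1 0 "Suc c" d] by (simp add: reach_def)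
  then have 1: "\<not> Suc c + b \<le> n" using t(3) ball_if_reach V by blast
  have "reach a d x t"
    using cd t yt V reach_le_trans[of y c x d t 1 0 "Suc c" d] by (simp add: reach_def)
  then have 2: "\<not> a + d \<le> n" using t(3) ball_if_reach V by blast
  have "a = Suc c" "d = b" using 1 2 cd(1) t(2) by linarith+
  then show ?thesis using cd by blast
qed

lemma reach_successor:
  assumes t: "reach a b x t" "a + b = Suc n" "\<not> ball n x t" and y: "ball n x y"
    and yt: "t \<sqsubseteq> y" "y \<sqsubseteq> s 1 t" and V: "x \<in> V" "y \<in> V" "t \<in> V"
  shows "\<exists>k. b = Suc k \<and> reach a k x y"
proof -
  obtain c d where cd: "c + d = n" "reach c d x y" using y by (auto simp: ball_def)
  have "reach c (Suc d) x t"
    using cd t yt V reach_le_trans[of y c x d t 0 1 c "Suc d"] by (simp add: reach_def)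
  then have d: "x \<sqsubseteq> s (int (Suc d)) t" and c: "t \<sqsubseteq> s (int c) x" by (simp_all add: reach_def)
  then have "reach a (Suc d) x t" "reach c b x t" using t(1) by (simp_all add: reach_def)
  then have "\<not> a + Suc d \<le> n" "\<not> c + b \<le> n" using t(3) ball_if_reach V by blast+
  then have "c = a" "b = Suc d" using cd(1) t(2) by linarith+
  then show ?thesis using cd by blast
qed

text \<open>Mixing the bounds of the two points along the edge lets \<open>(Suc a, d)\<close> reach
  \<open>z\<close> and \<open>(c, b)\<close> reach \<open>y\<close>. Both sums exceed
  \<open>n\<close> and add up to \<open>2 n + 3\<close>, which leaves two cases: equal types, or
  \<open>z\<close> having one more upward and one less downward step than \<open>y\<close>.\<close>

lemma ball_triangle:
  assumes V: "x \<in> V" "y \<in> V" "z \<in> V" and yz: "y \<sqsubseteq> z" "z \<sqsubseteq> s 1 y"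
    and y: "ball (Suc n) x y" "\<not> ball n x y" and z: "ball (Suc n) x z" "\<not> ball n x z"
  shows "\<exists>w\<in>V. ball n x w \<and> close w y \<and> close w z"
proof -
  obtain a b where ab: "a + b = Suc n" "reach a b x y" using y by (auto simp: ball_def)
  obtain c d where cd: "c + d = Suc n" "reach c d x z" using z by (auto simp: ball_def)
  have "reach (Suc a) b x z" and *: "reach c (Suc d) x y"
    using ab cd yz V reach_le_trans[of y a x b z 1 0 "Suc a" b]
      reach_le_trans[of z c x d y 0 1 c "Suc d"] by (simp_all add: reach_def)
  then have "reach (Suc a) d x z" "reach c b x y" using ab cd by (simp_all add: reach_def)
  then have "\<not> Suc a + d \<le> n" "\<not> c + b \<le> n" using y(2) z(2) ball_if_reach V by blast+
  then consider "c = a" "d = b" | "c = Suc a" "b = Suc d" using ab(1) cd(1) by linarith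
  then show ?thesis
  proof cases
    case 1
    have "y \<sqsubseteq> s 1 z" using le_shift_trans[of y 0 z 0 z 1] yz V by simp
    then show ?thesis using common_neighbour_same_type ab cd 1 yz V by blast
  next
    case 2
    have "z \<sqsubseteq> s 2 y" using le_shift_trans[of z 1 y 0 y 2] yz V by simp
    then show ?thesis using common_neighbour_mixed_type[of a d x y z] ab cd 2 yz V by simp
  qed
qed

text \<open>The type of \<open>t\<close> dictates the types of its neighbours nearer to
  \<open>x\<close>: those below \<open>t\<close> lose an upward step, those above it a downward
  step. Neighbours on the same side of \<open>t\<close> thus have equal types, and neighbours on
  opposite sides have mixed types.\<close>

lemma ball_quadrangle:
  assumes V: "x \<in> V" "y \<in> V" "z \<in> V" "t \<in> V" and yt: "close y t" and zt: "close z t"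
    and y: "ball (Suc n) x y" and z: "ball (Suc n) x z"
    and t: "ball (Suc (Suc n)) x t" "\<not> ball (Suc n) x t"
  shows "\<exists>w\<in>V. ball n x w \<and> close w y \<and> close w z"
proof -
  obtain a b where ab: "reach a b x t" "a + b = Suc (Suc n)" using t by (auto simp: ball_def)
  have mixed: "\<exists>w\<in>V. ball n x w \<and> close w u \<and> close w v"
    if uv: "u \<in> V" "v \<in> V" "ball (Suc n) x u" "ball (Suc n) x v"
      and u: "u \<sqsubseteq> t" "t \<sqsubseteq> s 1 u" and v: "t \<sqsubseteq> v" "v \<sqsubseteq> s 1 t" for u v
  proof -
    obtain k l where "a = Suc k" "reach k b x u" "b = Suc l" "reach a l x v"
      using reach_predecessor[OF ab t(2)] reach_successor[OF ab t(2)] uv u v V by blast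
    moreover have "u \<sqsubseteq> v" "v \<sqsubseteq> s 2 u"
      using le_shift_trans[of u 0 t 0 v 0] le_shift_trans[of v 1 t 1 u 2] uv u v V by simp_all
    ultimately show ?thesis
      using common_neighbour_mixed_type[of k l x u v] uv V ab by simp
  qed
  consider (below) "y \<sqsubseteq> t" "t \<sqsubseteq> s 1 y" "z \<sqsubseteq> t" "t \<sqsubseteq> s 1 z"
    | (above) "t \<sqsubseteq> y" "y \<sqsubseteq> s 1 t" "t \<sqsubseteq> z" "z \<sqsubseteq> s 1 t"
    | (yz) "y \<sqsubseteq> t" "t \<sqsubseteq> s 1 y" "t \<sqsubseteq> z" "z \<sqsubseteq> s 1 t"
    | (zy) "z \<sqsubseteq> t" "t \<sqsubseteq> s 1 z" "t \<sqsubseteq> y" "y \<sqsubseteq> s 1 t"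
    using yt zt unfolding close_def by blast
  then show ?thesis
  proof cases
    case below
    then obtain k where "a = Suc k" "reach k b x y" "reach k b x z"
      using reach_predecessor[OF ab t(2) y] reach_predecessor[OF ab t(2) z] V by blast
    moreover have "y \<sqsubseteq> s 1 z" "z \<sqsubseteq> s 1 y"
      using below V le_shift_trans[of y 0 t 1 z 1] le_shift_trans[of z 0 t 1 y 1] by simp_all
    ultimately show ?thesis
      using common_neighbour_same_type[of k b x y z n] ab V by simp
  next
    case above
    then obtain k where "b = Suc k" "reach a k x y" "reach a k x z"
      using reach_successor[OF ab t(2) y] reach_successor[OF ab t(2) z] V by blast
    moreover have "y \<sqsubseteq> s 1 z" "z \<sqsubseteq> s 1 y"
      using above V le_shift_trans[of y 1 t 0 z 1] le_shift_trans[of z 1 t 0 y 1] by simp_all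
    ultimately show ?thesis
      using common_neighbour_same_type[of a k x y z n] ab V by simp
  next
    case yz
    then show ?thesis using mixed[of y z] y z V by blast
  next
    case zy
    then show ?thesis using mixed[of z y] y z V by blast
  qed
qed

theorem weakly_modular_graph: "weakly_modular \<Gamma>"
proof (rule weakly_modularI)
  fix n x y z
  assume "x \<in> V" "y \<in> V" "z \<in> V" "close y z" "ball (Suc n) x y" "ball (Suc n) x z"
    "\<not> ball n x y" "\<not> ball n x z"
  then show "\<exists>w\<in>V. ball n x w \<and> close w y \<and> close w z"
    using ball_triangle[of x y z n] ball_triangle[of x z y n] unfolding close_def by blast
next
  fix n x y z t
  assume "x \<in> V" "y \<in> V" "z \<in> V" "t \<in> V" "close y t" "close z t" "ball (Suc n) x y"
    "ball (Suc n) x z" "ball (Suc (Suc n)) x t" "\<not> ball (Suc n) x t"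
  then show "\<exists>w\<in>V. ball n x w \<and> close w y \<and> close w z"
    by (rule ball_quadrangle)
qed

section \<open>The quotient by the shift\<close>

definition shift_orbit :: "'a \<Rightarrow> 'a set" where
  "shift_orbit u = range (\<lambda>k. s k u)"

text \<open>Some translate of \<open>v\<close> lies between \<open>u\<close> and \<open>s n u\<close>; this is the ball of radius \<open>n\<close> in the
  quotient, expressed on representatives.\<close>

definition qball :: "nat \<Rightarrow> 'a \<Rightarrow> 'a \<Rightarrow> bool" where
  "qball n u v \<longleftrightarrow> (\<exists>k. u \<sqsubseteq> s k v \<and> v \<sqsubseteq> s (int n - k) u)"

definition orbit_ball :: "nat \<Rightarrow> 'a set \<Rightarrow> 'a set \<Rightarrow> bool" where
  "orbit_ball n X Y \<longleftrightarrow> (\<exists>u\<in>X. \<exists>v\<in>Y. qball n u v)"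

lemma qball_shift:
  assumes "u \<in> V" "v \<in> V"
  shows "qball n (s i u) (s j v) \<longleftrightarrow> qball n u v"
proof -
  have "qball n (s i u) (s j v) \<longleftrightarrow>
      (\<exists>k. u \<sqsubseteq> s (k + j - i) v \<and> v \<sqsubseteq> s (int n - (k + j - i)) u)"
    using assms by (simp add: qball_def shift_iff algebra_simps)
  also have "\<dots> \<longleftrightarrow> qball n u v"
    unfolding qball_def by (metis add_diff_cancel diff_add_cancel)
  finally show ?thesis .
qed

lemma orbit_ball_iff:
  "\<lbrakk>u \<in> V; v \<in> V\<rbrakk> \<Longrightarrow> orbit_ball n (shift_orbit u) (shift_orbit v) \<longleftrightarrow> qball n u v"
  by (auto simp: orbit_ball_def shift_orbit_def qball_shift)

lemma shift_orbit_eq_iff: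
  assumes "u \<in> V" "v \<in> V"
  shows "shift_orbit u = shift_orbit v \<longleftrightarrow> (\<exists>k. u = s k v)"
proof
  assume "shift_orbit u = shift_orbit v"
  moreover have "u \<in> shift_orbit u" using assms unfolding shift_orbit_def by (intro range_eqI[of _ _ 0]) simp
  ultimately show "\<exists>k. u = s k v" by (auto simp: shift_orbit_def)
next
  assume "\<exists>k. u = s k v"
  then obtain k where k: "u = s k v" by blast
  have "s i u = s (i + k) v" "s i v = s (i - k) u" for i using k assms by simp_all
  then show "shift_orbit u = shift_orbit v" unfolding shift_orbit_def by blast
qed

lemma qball_Suc_iff:
  assumes V: "x \<in> V" "y \<in> V"
  shows "qball (Suc n) x y \<longleftrightarrow> (\<exists>z\<in>V. qball n x z \<and> qball 1 z y)"
proof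
  assume "\<exists>z\<in>V. qball n x z \<and> qball 1 z y"
  then obtain z k l where z: "z \<in> V" "x \<sqsubseteq> s k z" "z \<sqsubseteq> s (int n - k) x" "z \<sqsubseteq> s l y"
    "y \<sqsubseteq> s (1 - l) z" by (auto simp: qball_def)
  have "x \<sqsubseteq> s (k + l) y" "y \<sqsubseteq> s (int (Suc n) - (k + l)) x"
    using le_shift_trans[of x k z l y "k + l"]
      le_shift_trans[of y "1 - l" z "int n - k" x "int (Suc n) - (k + l)"] z V by simp_all
  then show "qball (Suc n) x y" unfolding qball_def by blast
next
  assume "qball (Suc n) x y"
  then obtain k where k: "x \<sqsubseteq> s k y" "y \<sqsubseteq> s (int (Suc n) - k) x"
    by (auto simp: qball_def)
  \<comment> \<open>The translate \<open>?y\<close> lies between \<open>x\<close> and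
    \<open>s (Suc n) x\<close>. The vertex \<open>z\<close> is to lie within one shift below
    \<open>?y\<close> and still between \<open>x\<close> and \<open>?t\<close>.\<close>
  let ?y = "s k y" and ?q = "s (k - 1) y" and ?t = "s (int n) x"
  have "\<forall>t\<in>{?y, ?t}. t \<in> V \<and> x \<sqsubseteq> t \<and> ?q \<sqsubseteq> t"
    using k V by (auto simp: shift_iff le_shift algebra_simps)
  then obtain z where z: "z \<in> V" "x \<sqsubseteq> z" "?q \<sqsubseteq> z" "z \<sqsubseteq> ?y" "z \<sqsubseteq> ?t"
    using interpolate[of x ?q ?q "{?y, ?t}"] V by auto
  then have "qball n x z"
    using V by (auto simp: qball_def intro!: exI[of _ 0])
  moreover have "qball 1 z y"
    using z V unfolding qball_def by (intro exI[of _ k]) (simp add: shift_left_iff)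
  ultimately show "\<exists>z\<in>V. qball n x z \<and> qball 1 z y" using z(1) by blast
qed

lemma qball_sym:
  assumes "qball n u v"
  shows "qball n v u"
proof -
  obtain k where "u \<sqsubseteq> s k v" "v \<sqsubseteq> s (int n - k) u" using assms by (auto simp: qball_def)
  then show ?thesis unfolding qball_def by (intro exI[of _ "int n - k"]) simp
qed

interpretation quotient: ball_system "shift_orbit ` V" "orbit_ball 1" orbit_ball
proof
  fix X Y assume "X \<in> shift_orbit ` V" "Y \<in> shift_orbit ` V"
  then obtain u v where uv: "u \<in> V" "v \<in> V" "X = shift_orbit u" "Y = shift_orbit v" by blast
  \<comment> \<open>At radius 0 the two inequalities of \<open>qball\<close> are opposite, so
    antisymmetry makes a translate of \<open>v\<close> equal to \<open>u\<close>.\<close>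
  have "u = s k v \<longleftrightarrow> u \<sqsubseteq> s k v \<and> v \<sqsubseteq> s (- k) u" for k
    using uv le_antisym[of u "s k v"] by (auto simp: shift_left_iff)
  then show "orbit_ball 0 X Y \<longleftrightarrow> X = Y"
    using uv by (simp add: orbit_ball_iff shift_orbit_eq_iff qball_def)
  show "orbit_ball (Suc n) X Y \<longleftrightarrow> (\<exists>Z\<in>shift_orbit ` V. orbit_ball n X Z \<and> orbit_ball 1 Z Y)" for n
    using uv by (simp add: orbit_ball_iff qball_Suc_iff)
  show "orbit_ball 1 X X"
    using uv by (auto simp: orbit_ball_iff qball_def le_shift intro!: exI[of _ 0])
  show "orbit_ball 1 Y X" if "orbit_ball 1 X Y"
    using uv that by (simp add: orbit_ball_iff qball_sym)
qed

text \<open>Once the representatives of \<open>y\<close> and \<open>z\<close> lie in the interval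
  from \<open>x\<close> to \<open>s (Suc n) x\<close> and within one shift of each other, a single
  configuration remains: a vertex of the interval from \<open>x\<close> to \<open>s n x\<close> that
  lies one step below both.\<close>

lemma qball_common_neighbour:
  assumes V: "x \<in> V" "y \<in> V" "z \<in> V"
    and y: "x \<sqsubseteq> y" "y \<sqsubseteq> s (int (Suc n)) x" and z: "x \<sqsubseteq> z" "z \<sqsubseteq> s (int (Suc n)) x"
    and yz: "y \<sqsubseteq> s 1 z" "z \<sqsubseteq> s 1 y"
  shows "\<exists>w\<in>V. qball n x w \<and> qball 1 w y \<and> qball 1 w z"
proof -
  let ?p = "s (- 1) y" and ?q = "s (- 1) z" and ?t = "s (int n) x"
  have "\<forall>t\<in>{y, z, ?t}. t \<in> V \<and> ?p \<sqsubseteq> t \<and> ?q \<sqsubseteq> t \<and> x \<sqsubseteq> t"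
    using y z yz V by (auto simp: shift_iff shift_left_iff le_shift add.commute)
  then obtain w where w: "w \<in> V" "?p \<sqsubseteq> w" "?q \<sqsubseteq> w" "x \<sqsubseteq> w" "w \<sqsubseteq> y" "w \<sqsubseteq> z" "w \<sqsubseteq> ?t"
    using interpolate[of ?p ?q x "{y, z, ?t}"] V by auto
  then have "qball n x w" "qball 1 w y" "qball 1 w z"
    using V by (auto simp: qball_def shift_left_iff intro!: exI[of _ 0])
  then show ?thesis using w(1) by blast
qed

lemma qball_triangle:
  assumes V: "x \<in> V" "y \<in> V" "z \<in> V" and yz: "qball 1 y z"
    and y: "qball (Suc n) x y" and z: "qball (Suc n) x z"
  shows "\<exists>w\<in>V. qball n x w \<and> qball 1 w y \<and> qball 1 w z"
proof -
  obtain i where i: "x \<sqsubseteq> s i y" "y \<sqsubseteq> s (int (Suc n) - i) x" using y by (auto simp: qball_def)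
  obtain j where j: "x \<sqsubseteq> s j z" "z \<sqsubseteq> s (int (Suc n) - j) x" using z by (auto simp: qball_def)
  obtain k where k: "y \<sqsubseteq> s k z" "z \<sqsubseteq> s (1 - k) y" using yz by (auto simp: qball_def)
  txt \<open>\<open>s (i + k) z\<close> lies just above \<open>s i y\<close> and \<open>s (i + k - 1) z\<close> just below; at least one of the
    two lies between \<open>x\<close> and \<open>s (Suc n) x\<close>.\<close>
  define l where "l = (if i + k \<le> j then i + k else i + k - 1)"
  have "x \<sqsubseteq> s l z" "z \<sqsubseteq> s (int (Suc n) - l) x" "y \<sqsubseteq> s (1 + l - i) z" "z \<sqsubseteq> s (1 + i - l) y"
  proof -
    \<comment> \<open>If \<open>i + k \<le> j\<close>, the lower bound on \<open>s l z\<close>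
      passes through \<open>s i y\<close> and its upper bound through \<open>s j z\<close>;
      otherwise the two exchange roles.\<close>
    show "x \<sqsubseteq> s l z"
    proof (cases "i + k \<le> j")
      case True
      then show ?thesis using le_shift_trans[of x i y k z l] i k V by (simp add: l_def)
    next
      case False
      then show ?thesis using le_shift_trans[of x j z 0 z l] j V by (simp add: l_def)
    qed
    show "z \<sqsubseteq> s (int (Suc n) - l) x"
    proof (cases "i + k \<le> j")
      case True
      then show ?thesis
        using le_shift_trans[of z "int (Suc n) - j" x 0 x "int (Suc n) - l"] j V by (simp add: l_def)
    next
      case False
      then show ?thesis
        using le_shift_trans[of z "1 - k" y "int (Suc n) - i" x "int (Suc n) - l"] i k V
        by (simp add: l_def)
    qed
    show "y \<sqsubseteq> s (1 + l - i) z" "z \<sqsubseteq> s (1 + i - l) y"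
      using le_shift_trans[of y k z 0 z "1 + l - i"] le_shift_trans[of z "1 - k" y 0 y "1 + i - l"] k V
      by (auto simp: l_def)
  qed
  then have "\<exists>w\<in>V. qball n x w \<and> qball 1 w (s i y) \<and> qball 1 w (s l z)"
    using V i by (intro qball_common_neighbour) (simp_all add: shift_iff)
  then show ?thesis using V qball_shift[of _ _ 1 0] by simp
qed

text \<open>Fix the exponent \<open>i\<close> that places \<open>t\<close>. If a neighbour
  \<open>u\<close> of \<open>t\<close> is placed by \<open>j\<close>, and \<open>k\<close> relates
  \<open>u\<close> to \<open>t\<close>, then \<open>j + k = i\<close>, as any other value would put
  \<open>t\<close> in the ball of radius \<open>Suc n\<close>. So the translates
  \<open>s j y\<close> and \<open>s k z\<close> used below both lie between
  \<open>s (i - 1) t\<close> and \<open>s i t\<close>, hence within one shift of each other.\<close>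

lemma qball_quadrangle:
  assumes V: "x \<in> V" "y \<in> V" "z \<in> V" "t \<in> V" and yt: "qball 1 y t" and zt: "qball 1 z t"
    and y: "qball (Suc n) x y" and z: "qball (Suc n) x z"
    and t: "qball (Suc (Suc n)) x t" "\<not> qball (Suc n) x t"
  shows "\<exists>w\<in>V. qball n x w \<and> qball 1 w y \<and> qball 1 w z"
proof -
  obtain i where i: "x \<sqsubseteq> s i t" "t \<sqsubseteq> s (int (Suc (Suc n)) - i) x" using t by (auto simp: qball_def)
  have *: "\<exists>j. x \<sqsubseteq> s j u \<and> u \<sqsubseteq> s (int (Suc n) - j) x \<and> u \<sqsubseteq> s (i - j) t \<and> t \<sqsubseteq> s (1 + j - i) u"
    if u: "u \<in> V" "qball 1 u t" "qball (Suc n) x u" for u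
  proof -
    obtain j where j: "x \<sqsubseteq> s j u" "u \<sqsubseteq> s (int (Suc n) - j) x" using u by (auto simp: qball_def)
    obtain k where k: "u \<sqsubseteq> s k t" "t \<sqsubseteq> s (1 - k) u" using u by (auto simp: qball_def)
    have "j + k = i"
    proof (rule ccontr)
      assume "j + k \<noteq> i"
      then consider "i + 1 \<le> j + k" | "j + k + 1 \<le> i" by linarith
      then have "qball (Suc n) x t"
      proof cases
        case 1
        then have "t \<sqsubseteq> s (int (Suc n) - i) x"
          using le_shift_trans[of t "1 - k" u "int (Suc n) - j" x "int (Suc n) - i"] j k u V by simp
        then show ?thesis using i by (auto simp: qball_def)
      next
        case 2
        then have "x \<sqsubseteq> s (i - 1) t"
          using le_shift_trans[of x j u k t "i - 1"] j k u V by simp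
        moreover have "int (Suc (Suc n)) - i = int (Suc n) - (i - 1)" by simp
        ultimately show ?thesis using i(2) unfolding qball_def by metis
      qed
      then show False using t by blast
    qed
    then have "k = i - j" "1 - k = 1 + j - i" by simp_all
    then show ?thesis using j k by metis
  qed
  obtain j where j: "x \<sqsubseteq> s j y" "y \<sqsubseteq> s (int (Suc n) - j) x" "y \<sqsubseteq> s (i - j) t" "t \<sqsubseteq> s (1 + j - i) y"
    using *[of y] V yt y by blast
  obtain k where k: "x \<sqsubseteq> s k z" "z \<sqsubseteq> s (int (Suc n) - k) x" "z \<sqsubseteq> s (i - k) t" "t \<sqsubseteq> s (1 + k - i) z"
    using *[of z] V zt z by blast
  have "y \<sqsubseteq> s (1 + k - j) z" "z \<sqsubseteq> s (1 + j - k) y"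
    using le_shift_trans[OF j(3) k(4), of "1 + k - j"] le_shift_trans[OF k(3) j(4), of "1 + j - k"] V
    by simp_all
  then have "\<exists>w\<in>V. qball n x w \<and> qball 1 w (s j y) \<and> qball 1 w (s k z)"
    using V j k by (intro qball_common_neighbour) (simp_all add: shift_iff)
  then show ?thesis using V qball_shift[of _ _ 1 0] by simp
qed

lemma quotient_graph_eq: "quotient_graph \<Gamma> (shift_orbit ` V) = quotient.\<Gamma>"
proof -
  have "(\<exists>a\<in>X. \<exists>b\<in>Y. (a, b) \<in> edges \<Gamma>) \<longleftrightarrow> orbit_ball 1 X Y"
    if XY: "X \<in> shift_orbit ` V" "Y \<in> shift_orbit ` V" "X \<noteq> Y" for X Y
  proof -
    obtain u v where uv: "u \<in> V" "v \<in> V" "X = shift_orbit u" "Y = shift_orbit v" using XY by blast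
    have ne: "s i u \<noteq> s j v" for i j
    proof
      assume "s i u = s j v"
      then have "u = s (j - i) v" using uv s_s[of u "- i" i] by simp
      then show False using XY uv by (auto simp: shift_orbit_eq_iff)
    qed
    have "(\<exists>a\<in>X. \<exists>b\<in>Y. (a, b) \<in> edges \<Gamma>) \<longleftrightarrow> (\<exists>i j. close (s i u) (s j v))"
      using uv ne by (auto simp: shift_orbit_def)
    also have "\<dots> \<longleftrightarrow> qball 1 u v"
    proof
      assume "\<exists>i j. close (s i u) (s j v)"
      then obtain i j where "close (s i u) (s j v)" by blast
      \<comment> \<open>The exponent in \<open>qball\<close> is 0 when the first element is the
        lower one and 1 when it is the upper one.\<close>
      then have "qball 1 (s i u) (s j v)"
        using uv unfolding close_def qball_def
        by (auto simp: shift_iff algebra_simps intro: exI[of _ 0] exI[of _ 1])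
      then show "qball 1 u v" using uv by (simp add: qball_shift)
    next
      assume "qball 1 u v"
      then obtain k where "u \<sqsubseteq> s k v" "v \<sqsubseteq> s (1 - k) u" by (auto simp: qball_def)
      then have "close (s 0 u) (s k v)"
        using uv by (simp add: close_def shift_left_iff shift_iff)
      then show "\<exists>i j. close (s i u) (s j v)" by blast
    qed
    finally show ?thesis using uv by (simp add: orbit_ball_iff)
  qed
  then have "{(X, Y). X \<in> shift_orbit ` V \<and> Y \<in> shift_orbit ` V \<and> X \<noteq> Y \<and> (\<exists>a\<in>X. \<exists>b\<in>Y. (a, b) \<in> edges \<Gamma>)}
      = {(X, Y). X \<in> shift_orbit ` V \<and> Y \<in> shift_orbit ` V \<and> X \<noteq> Y \<and> orbit_ball 1 X Y}" by blast
  then show ?thesis unfolding quotient_graph_def by simp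
qed

theorem weakly_modular_quotient: "weakly_modular (quotient_graph \<Gamma> (shift_orbit ` V))"
  unfolding quotient_graph_eq
proof (rule quotient.weakly_modularI)
  fix n X Y Z
  assume "X \<in> shift_orbit ` V" "Y \<in> shift_orbit ` V" "Z \<in> shift_orbit ` V"
    and *: "orbit_ball 1 Y Z" "orbit_ball (Suc n) X Y" "orbit_ball (Suc n) X Z"
  then obtain x y z where V: "x \<in> V" "y \<in> V" "z \<in> V"
    and "X = shift_orbit x" "Y = shift_orbit y" "Z = shift_orbit z" by blast
  then show "\<exists>W\<in>shift_orbit ` V. orbit_ball n X W \<and> orbit_ball 1 W Y \<and> orbit_ball 1 W Z"
    using qball_triangle[OF V, of n] * by (simp add: orbit_ball_iff)
next
  fix n X Y Z T
  assume "X \<in> shift_orbit ` V" "Y \<in> shift_orbit ` V" "Z \<in> shift_orbit ` V" "T \<in> shift_orbit ` V"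
    and *: "orbit_ball 1 Y T" "orbit_ball 1 Z T" "orbit_ball (Suc n) X Y" "orbit_ball (Suc n) X Z"
    "orbit_ball (Suc (Suc n)) X T" "\<not> orbit_ball (Suc n) X T"
  then obtain x y z t where V: "x \<in> V" "y \<in> V" "z \<in> V" "t \<in> V"
    and "X = shift_orbit x" "Y = shift_orbit y" "Z = shift_orbit z" "T = shift_orbit t" by blast
  then show "\<exists>W\<in>shift_orbit ` V. orbit_ball n X W \<and> orbit_ball 1 W Y \<and> orbit_ball 1 W Z"
    using qball_quadrangle[OF V, of n] * by (simp add: orbit_ball_iff)
qed

end

section \<open>Integer iterates of a permutation\<close>

text \<open>The power is taken inside \<open>BijGroup V\<close>, so that the exponent laws are those
  of a group and the elements of the subgroup generated by \<open>\<sigma>\<close> are literally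
  these iterates.\<close>

definition int_iterate :: "'a set \<Rightarrow> ('a \<Rightarrow> 'a) \<Rightarrow> int \<Rightarrow> 'a \<Rightarrow> 'a" where
  "int_iterate V \<sigma> k = restrict \<sigma> V [^]\<^bsub>BijGroup V\<^esub> k"

lemma carrier_BijGroup: "carrier (BijGroup V) = Bij V"
  by (simp add: BijGroup_def)

lemma restrict_in_BijGroup: "bij_betw \<sigma> V V \<Longrightarrow> restrict \<sigma> V \<in> carrier (BijGroup V)"
  by (simp add: carrier_BijGroup Bij_def)

lemma int_iterate_Bij:
  assumes "bij_betw \<sigma> V V"
  shows "int_iterate V \<sigma> k \<in> Bij V"
  unfolding int_iterate_def carrier_BijGroup[symmetric]
  by (rule group.int_pow_closed[OF group_BijGroup restrict_in_BijGroup[OF assms]])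

lemma int_iterate_in: "\<lbrakk>bij_betw \<sigma> V V; u \<in> V\<rbrakk> \<Longrightarrow> int_iterate V \<sigma> k u \<in> V"
  by (rule funcset_mem[OF Bij_imp_funcset[OF int_iterate_Bij]])

lemma int_iterate_0: "u \<in> V \<Longrightarrow> int_iterate V \<sigma> 0 u = u"
  unfolding int_iterate_def int_pow_0 by (simp add: BijGroup_def)

lemma int_iterate_1: "\<lbrakk>bij_betw \<sigma> V V; u \<in> V\<rbrakk> \<Longrightarrow> int_iterate V \<sigma> 1 u = \<sigma> u"
  unfolding int_iterate_def
  by (subst group.int_pow_1[OF group_BijGroup restrict_in_BijGroup]) simp_all

lemma int_iterate_add:
  assumes "bij_betw \<sigma> V V" "u \<in> V"
  shows "int_iterate V \<sigma> i (int_iterate V \<sigma> j u) = int_iterate V \<sigma> (i + j) u"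
proof -
  have "int_iterate V \<sigma> (i + j) = int_iterate V \<sigma> i \<otimes>\<^bsub>BijGroup V\<^esub> int_iterate V \<sigma> j"
    unfolding int_iterate_def
    by (rule group.int_pow_mult[OF group_BijGroup restrict_in_BijGroup[OF assms(1)]])
  also have "\<dots> = compose V (int_iterate V \<sigma> i) (int_iterate V \<sigma> j)"
    using int_iterate_Bij[OF assms(1)] unfolding BijGroup_def by simp
  finally show ?thesis using assms(2) by (simp add: compose_eq)
qed

lemma cyclic_orbits_eq:
  assumes "bij_betw \<sigma> V V"
  shows "cyclic_orbits V \<sigma> = (\<lambda>u. range (\<lambda>k. int_iterate V \<sigma> k u)) ` V"
proof -
  let ?B = "BijGroup V" and ?r = "restrict \<sigma> V"
  have "carrier ?B \<inter> {?r} = {?r}" using restrict_in_BijGroup[OF assms] by (simp add: Int_insert_right)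
  then have "carrier (subgroup_generated ?B {?r}) = range (int_iterate V \<sigma>)"
    unfolding carrier_subgroup_generated int_iterate_def
    by (simp add: group.generate_pow[OF group_BijGroup restrict_in_BijGroup[OF assms]] full_SetCompr_eq)
  then have "orbit (subgroup_generated ?B {?r}) (\<lambda>\<tau>. \<tau>) u = range (\<lambda>k. int_iterate V \<sigma> k u)" for u
    unfolding orbit_def by auto
  then show ?thesis
    unfolding cyclic_orbits_def orbits_def by blast
qed

section \<open>Faithfulness of the enveloping groupoid\<close>

text \<open>\<open>solves C w c d\<close> says that \<open>c = w d\<close> can be verified letter by letter with morphisms of
  \<open>C\<close>. It is a partial function of \<open>c\<close> with cofinal domain; rewriting a zigzag changes only the
  domain, which yields the faithfulness of the embedding of \<open>C\<close> into its groupoid.\<close>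

fun solves :: "('o, 'm) cat \<Rightarrow> 'm letter list \<Rightarrow> 'm \<Rightarrow> 'm \<Rightarrow> bool" where
  "solves C [] c d \<longleftrightarrow> c = d"
| "solves C (Fwd f # w) c d \<longleftrightarrow>
     (\<exists>e\<in>Mor C. tgt C f = src C e \<and> c = f \<cdot>\<^bsub>C\<^esub> e \<and> solves C w e d)"
| "solves C (Bwd f # w) c d \<longleftrightarrow> solves C w (f \<cdot>\<^bsub>C\<^esub> c) d"

text \<open>Cancellation together with common right multiples: Ore's conditions for a groupoid of
  right fractions. Faithfulness is derived from them in \<open>env_emb_inj\<close> without
  constructing fractions.\<close>

locale ore_category = small_category C for C :: "('o, 'm) cat" (structure) +
  assumes cancel_left:
    "\<lbrakk>a \<in> Mor C; f \<in> Mor C; g \<in> Mor C; tgt C a = src C f; tgt C a = src C g; a \<cdot> f = a \<cdot> g\<rbrakk>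
      \<Longrightarrow> f = g"
    and cancel_right:
    "\<lbrakk>b \<in> Mor C; f \<in> Mor C; g \<in> Mor C; tgt C f = src C b; tgt C g = src C b; f \<cdot> b = g \<cdot> b\<rbrakk>
      \<Longrightarrow> f = g"
    and common_multiple:
    "\<lbrakk>f \<in> Mor C; g \<in> Mor C; src C f = src C g\<rbrakk>
      \<Longrightarrow> \<exists>p\<in>Mor C. \<exists>q\<in>Mor C. tgt C f = src C p \<and> tgt C g = src C q \<and> f \<cdot> p = g \<cdot> q"
begin

lemma solves_typed:
  assumes "is_path C x w y" "c \<in> Mor C" "src C c = x" "solves C w c d"
  shows "d \<in> Mor C \<and> src C d = y \<and> tgt C d = tgt C c"
  using assms
proof (induction w arbitrary: x c)
  case (Cons a w)
  show ?case
  proof (cases a)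
    case (Fwd f)
    then obtain e where e: "e \<in> Mor C" "src C e = tgt C f" "c = f \<cdot> e" "solves C w e d"
      using Cons.prems(4) by auto
    have f: "f \<in> Mor C" "is_path C (tgt C f) w y" using Cons.prems(1) Fwd by auto
    show ?thesis using Cons.IH[OF f(2) e(1,2,4)] e f(1) by simp
  next
    case (Bwd f)
    then have f: "f \<in> Mor C" "tgt C f = src C c" "is_path C (src C f) w y" "solves C w (f \<cdot> c) d"
      using Cons.prems by auto
    show ?thesis using Cons.IH[OF f(3) _ _ f(4)] f(1,2) Cons.prems(2) by simp
  qed
qed auto

lemma solves_append:
  "solves C (u @ v) c d \<longleftrightarrow> (\<exists>e. solves C u c e \<and> solves C v e d)"
proof (induction u arbitrary: c)
  case (Cons a u)
  then show ?case by (cases a) auto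
qed simp

lemma solves_mult:
  assumes "is_path C x w y" "c \<in> Mor C" "src C c = x" "e \<in> Mor C" "src C e = tgt C c"
    and "solves C w c d"
  shows "solves C w (c \<cdot> e) (d \<cdot> e)"
  using assms
proof (induction w arbitrary: x c)
  case (Cons a w)
  show ?case
  proof (cases a)
    case (Fwd f)
    then obtain c' where c': "c' \<in> Mor C" "src C c' = tgt C f" "c = f \<cdot> c'" "solves C w c' d"
      using Cons.prems(6) by auto
    have f: "f \<in> Mor C" "is_path C (tgt C f) w y" using Cons.prems(1) Fwd by auto
    have e: "src C e = tgt C c'" using Cons.prems(5) c' f by simp
    have "solves C w (c' \<cdot> e) (d \<cdot> e)"
      by (rule Cons.IH[OF f(2) c'(1,2) Cons.prems(4) e c'(4)])
    moreover have "c \<cdot> e = f \<cdot> (c' \<cdot> e)" "c' \<cdot> e \<in> Mor C" "src C (c' \<cdot> e) = tgt C f"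
      using c' f e Cons.prems(4) by (simp_all add: cmp_assoc)
    ultimately show ?thesis unfolding Fwd solves.simps by metis
  next
    case (Bwd f)
    then have f: "f \<in> Mor C" "tgt C f = src C c" "is_path C (src C f) w y" "solves C w (f \<cdot> c) d"
      using Cons.prems by auto
    then show ?thesis
      using Cons.IH[OF f(3) _ _ Cons.prems(4) _ f(4)] Cons.prems(2,4,5) Bwd by (simp add: cmp_assoc)
  qed
qed auto

lemma solves_functional:
  assumes "is_path C x w y" "c \<in> Mor C" "src C c = x" "solves C w c d" "solves C w c d'"
  shows "d = d'"
  using assms
proof (induction w arbitrary: x c)
  case (Cons a w)
  show ?case
  proof (cases a)
    case (Fwd f)
    then obtain e e' where e: "e \<in> Mor C" "src C e = tgt C f" "c = f \<cdot> e" "solves C w e d"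
      and e': "e' \<in> Mor C" "src C e' = tgt C f" "c = f \<cdot> e'" "solves C w e' d'"
      using Cons.prems(4,5) by auto
    have f: "f \<in> Mor C" "is_path C (tgt C f) w y" using Cons.prems(1) Fwd by auto
    have "e = e'"
      by (rule cancel_left[OF f(1) e(1) e'(1) e(2)[symmetric] e'(2)[symmetric]
            trans[OF e(3)[symmetric] e'(3)]])
    then show ?thesis using Cons.IH[OF f(2) e(1,2,4)] e'(4) by blast
  next
    case (Bwd f)
    then have f: "f \<in> Mor C" "tgt C f = src C c" "is_path C (src C f) w y"
      "solves C w (f \<cdot> c) d" "solves C w (f \<cdot> c) d'"
      using Cons.prems by auto
    show ?thesis using Cons.IH[OF f(3) _ _ f(4,5)] f(1,2) Cons.prems(2) by simp
  qed
qed auto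

text \<open>A backward letter imposes no condition. For a forward letter \<open>f\<close>, a common
  multiple \<open>c \<cdot> p = f \<cdot> q\<close> allows \<open>f\<close> to be stripped off, and
  the induction enlarges \<open>q\<close> further.\<close>

lemma solves_cofinal:
  assumes "is_path C x w y" "c \<in> Mor C" "src C c = x"
  shows "\<exists>e\<in>Mor C. src C e = tgt C c \<and> (\<exists>d. solves C w (c \<cdot> e) d)"
  using assms
proof (induction w arbitrary: x c)
  case Nil
  then show ?case by (intro bexI[of _ "ident C (tgt C c)"]) auto
next
  case (Cons a w)
  show ?case
  proof (cases a)
    case (Fwd f)
    then have f: "f \<in> Mor C" "src C c = src C f" "is_path C (tgt C f) w y"
      using Cons.prems by auto
    obtain p q where p: "p \<in> Mor C" "src C p = tgt C c" and q: "q \<in> Mor C" "src C q = tgt C f"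
      and pq: "c \<cdot> p = f \<cdot> q"
      using common_multiple[OF Cons.prems(2) f(1,2)] by metis
    obtain e d where e: "e \<in> Mor C" "src C e = tgt C q" "solves C w (q \<cdot> e) d"
      using Cons.IH[OF f(3) q] by blast
    have pqt: "tgt C q = tgt C p"
      using tgt_cmp[OF Cons.prems(2) p(1)] tgt_cmp[OF f(1) q(1)] pq p q by simp
    have "c \<cdot> (p \<cdot> e) = f \<cdot> (q \<cdot> e)"
      using pq p q e pqt f(1) Cons.prems(2) by (simp flip: cmp_assoc)
    moreover have "q \<cdot> e \<in> Mor C" "src C (q \<cdot> e) = tgt C f" using q e by simp_all
    ultimately have "solves C (a # w) (c \<cdot> (p \<cdot> e)) d"
      unfolding Fwd solves.simps using e(3) by metis
    then show ?thesis
      using p e pqt by (intro bexI[of _ "p \<cdot> e"]) auto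
  next
    case (Bwd f)
    then have f: "f \<in> Mor C" "tgt C f = src C c" "is_path C (src C f) w y"
      using Cons.prems by auto
    then obtain e d where e: "e \<in> Mor C" "src C e = tgt C c" "solves C w (f \<cdot> c \<cdot> e) d"
      using Cons.IH[of "src C f" "f \<cdot> c"] Cons.prems(2) by auto
    then have "solves C (a # w) (c \<cdot> e) d"
      using Bwd f(1,2) Cons.prems(2) by (simp add: cmp_assoc)
    then show ?thesis using e by blast
  qed
qed

text \<open>Only an implication holds: \<open>[Fwd f, Bwd f]\<close> requires \<open>f\<close> to
  divide \<open>c\<close>, whereas the empty word does not. Deleting \<open>[Bwd f, Fwd f]\<close>
  preserves the value by left cancellation.\<close>

lemma solves_relator:
  assumes "relator C u v" "is_path C x u y" "c \<in> Mor C" "src C c = x" "solves C u c d"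
  shows "solves C v c d"
  using assms(1)
proof cases
  case (relator_cmp f g)
  then obtain e where e: "e \<in> Mor C" "tgt C g = src C e" "c = f \<cdot> (g \<cdot> e)" "e = d"
    using assms(5) unfolding relator_cmp(1) solves.simps by blast
  have "c = f \<cdot> g \<cdot> e" "tgt C (f \<cdot> g) = src C e"
    using relator_cmp(3-5) e by (simp_all add: cmp_assoc)
  then show ?thesis using e unfolding relator_cmp(2) solves.simps by blast
next
  case (relator_ident z)
  then obtain e where "e \<in> Mor C" "src C e = z" "c = ident C z \<cdot> e" "e = d"
    using assms(5) by auto
  then show ?thesis using relator_ident(2) ident_left[of e] by simp
next
  case (relator_inv_right f)
  show ?thesis
    using assms(5) unfolding relator_inv_right(1,2) solves.simps by blast
next
  case (relator_inv_left f)
  then obtain e where e: "e \<in> Mor C" "tgt C f = src C e" "f \<cdot> c = f \<cdot> e" "e = d"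
    using assms(5) unfolding relator_inv_left(1) solves.simps by blast
  have "tgt C f = src C c" using assms(2,4) relator_inv_left by simp
  then have "c = e"
    by (rule cancel_left[OF relator_inv_left(3) assms(3) e(1) _ e(2,3)])
  then show ?thesis using e(4) relator_inv_left(2) by simp
qed

lemma solves_zstep:
  assumes "zstep C (x, w, y) (x, w', y)" "c \<in> Mor C" "src C c = x" "solves C w c d"
  shows "solves C w' c d"
proof -
  obtain u v p q where uv: "relator C u v" "w = p @ u @ q" "w' = p @ v @ q" "is_path C x w y"
    using assms(1) by (auto elim: zstep.cases)
  then obtain z t where p: "is_path C x p z" and u: "is_path C z u t"
    by (auto simp: is_path_append)
  obtain e e' where e: "solves C p c e" "solves C u e e'" "solves C q e' d"
    using assms(4) uv(2) by (auto simp: solves_append)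
  have "solves C v e e'"
    using solves_relator[OF uv(1) u] solves_typed[OF p assms(2,3) e(1)] e(2) by blast
  then show ?thesis using e uv(3) by (auto simp: solves_append)
qed

text \<open>The invariant of zigzag classes: wherever the zigzag can be evaluated, it acts as
  \<open>f\<close> does. Nothing is said about where that is.\<close>

definition represents :: "'m \<Rightarrow> ('o, 'm) zigzag \<Rightarrow> bool" where
  "represents f a \<longleftrightarrow> (\<forall>c d. c \<in> Mor C \<longrightarrow> src C c = fst a \<longrightarrow> solves C (fst (snd a)) c d \<longrightarrow> c = f \<cdot> d)"

text \<open>One direction is immediate, since a rewriting step can only extend the domain. For the
  other, a pair solved by the new word is multiplied on the right by some \<open>e\<close> that
  brings it into the domain of the old word, compared there, and \<open>e\<close> is
  cancelled.\<close>

lemma represents_zstep: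
  assumes f: "f \<in> Mor C" and z: "zstep C a b" and y: "snd (snd a) = tgt C f"
  shows "represents f a \<longleftrightarrow> represents f b"
proof -
  obtain x w w' where ab: "a = (x, w, tgt C f)" "b = (x, w', tgt C f)"
    and w: "is_path C x w (tgt C f)" "is_path C x w' (tgt C f)"
    using z y by (auto elim!: zstep.cases)
  have step: "solves C w c d \<Longrightarrow> solves C w' c d" if "c \<in> Mor C" "src C c = x" for c d
    using solves_zstep[of x w "tgt C f" w' c d] z ab that by simp
  have "c = f \<cdot> d"
    if a: "represents f a" and c: "c \<in> Mor C" "src C c = x" and s: "solves C w' c d" for c d
  proof -
    obtain e d' where e: "e \<in> Mor C" "src C e = tgt C c" "solves C w (c \<cdot> e) d'"
      using solves_cofinal[OF w(1) c] by blast
    have d: "d \<in> Mor C" "src C d = tgt C f" "tgt C d = tgt C c"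
      using solves_typed[OF w(2) c s] by auto
    have "solves C w' (c \<cdot> e) (d \<cdot> e)"
      using solves_mult[OF w(2) c e(1,2) s] .
    moreover have "solves C w' (c \<cdot> e) d'" using step e c by simp
    ultimately have "d' = d \<cdot> e"
      using solves_functional[OF w(2), of "c \<cdot> e"] c e by auto
    moreover have "c \<cdot> e = f \<cdot> d'"
      using a e c ab by (simp add: represents_def)
    ultimately have "c \<cdot> e = f \<cdot> d \<cdot> e" using f d e by (simp add: cmp_assoc)
    then show "c = f \<cdot> d" using cancel_right[of e c "f \<cdot> d"] c d e f by simp
  qed
  then show ?thesis using ab step by (auto simp: represents_def)
qed

lemma env_emb_inj: "inj_on (env_emb C) (Mor C)"
proof (rule inj_onI)
  fix f g assume f: "f \<in> Mor C" and g: "g \<in> Mor C" and eq: "env_emb C f = env_emb C g"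
  have st: "src C g = src C f" "tgt C g = tgt C f"
    using env_emb_props[OF f] env_emb_props[OF g] eq by simp_all
  have "((src C f, [Fwd f], tgt C f), (src C f, [Fwd g], tgt C f)) \<in> zrel C"
    using eq f g st by (subst zclass_eq_iff[symmetric]) (auto simp: env_emb_def)
  then have "(symclp (zstep C))\<^sup>*\<^sup>* (src C f, [Fwd f], tgt C f) (src C f, [Fwd g], tgt C f)"
    by (simp add: zrel_def)
  moreover have "(symclp (zstep C))\<^sup>*\<^sup>* a b \<Longrightarrow> snd (snd a) = tgt C f \<Longrightarrow> represents f a
      \<Longrightarrow> represents f b \<and> snd (snd b) = tgt C f" for a b
  proof (induction rule: rtranclp_induct)
    case (step b b')
    then have "snd (snd b) = tgt C f" "snd (snd b') = tgt C f"
      by (auto simp: symclp_def elim!: zstep.cases)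
    then show ?case
      using step represents_zstep[OF f, of b b'] represents_zstep[OF f, of b' b]
      unfolding symclp_def by blast
  qed auto
  moreover have "represents f (src C f, [Fwd f], tgt C f)"
    using f by (auto simp: represents_def)
  ultimately have "represents f (src C f, [Fwd g], tgt C f)" by fastforce
  \<comment> \<open>Evaluating \<open>[Fwd g]\<close> at \<open>g\<close> itself gives an identity,
    so the invariant reads \<open>g = f\<close> up to that identity.\<close>
  moreover have "solves C [Fwd g] g (ident C (tgt C g))"
    unfolding solves.simps using g ident_in src_ident ident_right tgt_in by metis
  ultimately have "g = f \<cdot> ident C (tgt C g)"
    using g st(1) unfolding represents_def by simp
  then show "f = g" using f st(2) by simp
qed

end

section \<open>Left divisibility in the enveloping groupoid\<close>

context homogeneous_garside
begin

lemma join_from: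
  assumes f: "f \<in> Mor C" and g: "g \<in> Mor C" and fg: "src C f = src C g"
  obtains p q where "p \<in> Mor C" "q \<in> Mor C" "src C p = tgt C f" "src C q = tgt C g" "f \<cdot> p = g \<cdot> q"
    "\<And>c d. \<lbrakk>c \<in> Mor C; d \<in> Mor C; src C c = tgt C f; src C d = tgt C g; f \<cdot> c = g \<cdot> d\<rbrakk>
      \<Longrightarrow> \<exists>r\<in>Mor C. src C r = tgt C p \<and> f \<cdot> c = f \<cdot> p \<cdot> r"
proof -
  let ?L = "from_poset C (src C f)"
  interpret lattice ?L using from_lattice f by simp
  obtain h where h: "least ?L h (Upper ?L {f, g})"
    using sup_of_two_exists[of f g] f g fg by (auto simp: from_poset_def)
  have "h \<in> Upper ?L {f, g}" using h by (simp add: least_def)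
  then have "(\<exists>p\<in>Mor C. tgt C f = src C p \<and> h = f \<cdot> p) \<and> (\<exists>q\<in>Mor C. tgt C g = src C q \<and> h = g \<cdot> q)"
    using f g fg unfolding Upper_def from_poset_def by simp
  then obtain p q where p: "p \<in> Mor C" "src C p = tgt C f" "h = f \<cdot> p"
    and q: "q \<in> Mor C" "src C q = tgt C g" "h = g \<cdot> q" by metis
  have "\<exists>r\<in>Mor C. src C r = tgt C p \<and> f \<cdot> c = f \<cdot> p \<cdot> r"
    if c: "c \<in> Mor C" "src C c = tgt C f" and d: "d \<in> Mor C" "src C d = tgt C g"
      and cd: "f \<cdot> c = g \<cdot> d" for c d
  proof -
    have m: "f \<cdot> c \<in> carrier ?L" using f c by (simp add: from_poset_def)
    have 1: "le ?L f (f \<cdot> c)" unfolding from_poset_def using c by (auto intro: bexI[of _ c])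
    have 2: "le ?L g (f \<cdot> c)" unfolding cd from_poset_def using d by (auto intro: bexI[of _ d])
    have "f \<cdot> c \<in> Upper ?L {f, g}" using m 1 2 unfolding Upper_def by blast
    then have "le ?L h (f \<cdot> c)" using h by (simp add: least_def)
    then obtain r where "r \<in> Mor C" "tgt C h = src C r" "f \<cdot> c = h \<cdot> r"
      by (auto simp: from_poset_def)
    moreover from this have "src C r = tgt C p" using tgt_cmp[OF f p(1)] p by simp
    ultimately show ?thesis unfolding p(3) by blast
  qed
  then show thesis using that[of p q] p q by metis
qed

text \<open>Two-sided cancellation with an identity on one side gives the one-sided laws; joins give
  common multiples.\<close>

sublocale ore_category C
proof
  have cancel: "f = g"
    if "a \<in> Mor C" "b \<in> Mor C" "f \<in> Mor C" "g \<in> Mor C" "tgt C a = src C f" "tgt C f = src C b"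
      "tgt C a = src C g" "tgt C g = src C b" "a \<cdot> f \<cdot> b = a \<cdot> g \<cdot> b" for a b f g
    using is_cancellative that unfolding cancellative_def by blast
  show "f = g" if a: "a \<in> Mor C" and f: "f \<in> Mor C" and g: "g \<in> Mor C"
    and af: "tgt C a = src C f" and ag: "tgt C a = src C g" and eq: "a \<cdot> f = a \<cdot> g" for a f g
  proof -
    have t: "tgt C g = tgt C f" using tgt_cmp[OF a f af] tgt_cmp[OF a g ag] eq by simp
    show ?thesis
      by (rule cancel[OF a ident_in[OF tgt_in[OF f]] f g af _ ag]) (use f t eq in simp_all)
  qed
  show "f = g" if b: "b \<in> Mor C" and f: "f \<in> Mor C" and g: "g \<in> Mor C"
    and fb: "tgt C f = src C b" and gb: "tgt C g = src C b" and eq: "f \<cdot> b = g \<cdot> b" for b f g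
  proof -
    have s: "src C g = src C f" using src_cmp[OF f b fb] src_cmp[OF g b gb] eq by simp
    have "ident C (src C f) \<cdot> g = g" using ident_left[OF g] s by simp
    then show ?thesis
      by (intro cancel[OF ident_in[OF src_in[OF f]] b f g _ fb _ gb]) (use f s eq in simp_all)
  qed
  show "\<exists>p\<in>Mor C. \<exists>q\<in>Mor C. tgt C f = src C p \<and> tgt C g = src C q \<and> f \<cdot> p = g \<cdot> q"
    if f: "f \<in> Mor C" and g: "g \<in> Mor C" and fg: "src C f = src C g" for f g
    by (rule join_from[OF f g fg]) metis
qed

end

locale based_garside = homogeneous_garside C \<phi>o \<phi>m \<Delta>
  for C :: "('o, 'm) cat" (structure) and \<phi>o \<phi>m \<Delta> +
  fixes x :: 'o
  assumes base_in: "x \<in> Ob C"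
begin

sublocale E: small_category \<G> by (rule small_category_env)

abbreviation "V \<equiv> mor_from \<G> x"
abbreviation "\<sigma> \<equiv> garside_automorphism C \<phi>o \<phi>m \<Delta> x"
abbreviation "e \<equiv> env_emb C"

definition prefix_le :: "('o, 'm) zigzag set \<Rightarrow> ('o, 'm) zigzag set \<Rightarrow> bool" where
  "prefix_le F G \<longleftrightarrow> (\<exists>c\<in>Mor C. src C c = tgt \<G> F \<and> G = F \<cdot>\<^bsub>\<G>\<^esub> e c)"

lemma mor_from_props: "F \<in> V \<Longrightarrow> F \<in> Mor \<G> \<and> src \<G> F = x \<and> tgt \<G> F \<in> Ob C"
  using E.tgt_in[of F] by (auto simp: mor_from_def)

lemma mult_in: "\<lbrakk>F \<in> V; G \<in> Mor \<G>; src \<G> G = tgt \<G> F\<rbrakk> \<Longrightarrow> F \<cdot>\<^bsub>\<G>\<^esub> G \<in> V"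
  by (simp add: mor_from_def)

lemma mult_emb:
  assumes "F \<in> V" "c \<in> Mor C" "src C c = tgt \<G> F"
  shows "F \<cdot>\<^bsub>\<G>\<^esub> e c \<in> V" "tgt \<G> (F \<cdot>\<^bsub>\<G>\<^esub> e c) = tgt C c"
  using assms by (simp_all add: mor_from_def env_emb_props)

lemma mult_emb_emb:
  assumes "F \<in> V" "c \<in> Mor C" "src C c = tgt \<G> F" "d \<in> Mor C" "src C d = tgt C c"
  shows "F \<cdot>\<^bsub>\<G>\<^esub> e c \<cdot>\<^bsub>\<G>\<^esub> e d = F \<cdot>\<^bsub>\<G>\<^esub> e (c \<cdot> d)"
  using assms by (simp add: mor_from_def env_emb_props env_emb_cmp E.cmp_assoc)

lemma mult_ident: "F \<in> V \<Longrightarrow> F \<cdot>\<^bsub>\<G>\<^esub> e (ident C (tgt \<G> F)) = F"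
  using mor_from_props[of F] E.ident_right[of F] by (simp add: env_emb_ident)

lemma mult_cancel_left:
  assumes "F \<in> V" "G \<in> Mor \<G>" "H \<in> Mor \<G>" "src \<G> G = tgt \<G> F" "src \<G> H = tgt \<G> F"
    and "F \<cdot>\<^bsub>\<G>\<^esub> G = F \<cdot>\<^bsub>\<G>\<^esub> H"
  shows "G = H"
proof -
  have F: "F \<in> Mor \<G>" using mor_from_props[OF assms(1)] by simp
  obtain I where I: "I \<in> Mor \<G>" "src \<G> I = tgt \<G> F" "tgt \<G> I = src \<G> F" "I \<cdot>\<^bsub>\<G>\<^esub> F = ident \<G> (tgt \<G> F)"
    using env_inverse[OF F] by metis
  have "I \<cdot>\<^bsub>\<G>\<^esub> (F \<cdot>\<^bsub>\<G>\<^esub> A) = A" if "A \<in> Mor \<G>" "src \<G> A = tgt \<G> F" for A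
    using that I F E.ident_left[of A] by (simp flip: E.cmp_assoc)
  then show ?thesis using assms by metis
qed

text \<open>This is where faithfulness enters: equations between multiples of a fixed
  \<open>F\<close> become equations in the category.\<close>

lemma mult_emb_cancel:
  assumes "F \<in> V" "c \<in> Mor C" "d \<in> Mor C" "src C c = tgt \<G> F" "src C d = tgt \<G> F"
    and "F \<cdot>\<^bsub>\<G>\<^esub> e c = F \<cdot>\<^bsub>\<G>\<^esub> e d"
  shows "c = d"
proof -
  have "e c = e d"
    by (rule mult_cancel_left[OF assms(1)]) (use assms in \<open>simp_all add: env_emb_props\<close>)
  then show ?thesis using env_emb_inj assms(2,3) by (simp add: inj_on_def)
qed

lemma \<sigma>_eq: "F \<in> V \<Longrightarrow> \<sigma> F = F \<cdot>\<^bsub>\<G>\<^esub> e (\<Delta> (tgt \<G> F))"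
  by (rule garside_automorphism_eq)

lemma \<sigma>_props: "F \<in> V \<Longrightarrow> \<sigma> F \<in> V \<and> tgt \<G> (\<sigma> F) = \<phi>o (tgt \<G> F)"
  using mor_from_props[of F] by (simp add: \<sigma>_eq mult_emb Delta_in src_Delta tgt_Delta)

lemma \<phi>m_in: "c \<in> Mor C \<Longrightarrow> \<phi>m c \<in> Mor C"
  using bij_mor by (auto simp: bij_betw_def)

lemma \<sigma>_mult:
  assumes "F \<in> V" "c \<in> Mor C" "src C c = tgt \<G> F"
  shows "\<sigma> (F \<cdot>\<^bsub>\<G>\<^esub> e c) = \<sigma> F \<cdot>\<^bsub>\<G>\<^esub> e (\<phi>m c)"
proof -
  have "\<sigma> (F \<cdot>\<^bsub>\<G>\<^esub> e c) = F \<cdot>\<^bsub>\<G>\<^esub> e c \<cdot>\<^bsub>\<G>\<^esub> e (\<Delta> (tgt C c))"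
    using assms by (simp add: \<sigma>_eq mult_emb)
  also have "\<dots> = F \<cdot>\<^bsub>\<G>\<^esub> e (c \<cdot> \<Delta> (tgt C c))"
    using assms by (simp add: mult_emb_emb Delta_in src_Delta)
  also have "\<dots> = F \<cdot>\<^bsub>\<G>\<^esub> e (\<Delta> (tgt \<G> F) \<cdot> \<phi>m c)"
    using assms(3) Delta_natural[OF assms(2)] by simp
  also have "\<dots> = \<sigma> F \<cdot>\<^bsub>\<G>\<^esub> e (\<phi>m c)"
    using assms mor_from_props[OF assms(1)]
    by (simp add: \<sigma>_eq mult_emb_emb Delta_in src_Delta tgt_Delta \<phi>m_in src_map)
  finally show ?thesis .
qed

lemma prefix_le_\<sigma>_iff:
  assumes F: "F \<in> V" and G: "G \<in> V"
  shows "prefix_le (\<sigma> F) (\<sigma> G) \<longleftrightarrow> prefix_le F G"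
proof
  assume "prefix_le F G"
  then obtain c where c: "c \<in> Mor C" "src C c = tgt \<G> F" "G = F \<cdot>\<^bsub>\<G>\<^esub> e c"
    by (auto simp: prefix_le_def)
  then have "\<sigma> G = \<sigma> F \<cdot>\<^bsub>\<G>\<^esub> e (\<phi>m c)" "src C (\<phi>m c) = tgt \<G> (\<sigma> F)"
    using F \<sigma>_mult[OF F c(1,2)] \<sigma>_props[OF F] by (simp_all add: src_map)
  then show "prefix_le (\<sigma> F) (\<sigma> G)" using \<phi>m_in[OF c(1)] by (auto simp: prefix_le_def)
next
  assume "prefix_le (\<sigma> F) (\<sigma> G)"
  then obtain d where d: "d \<in> Mor C" "src C d = tgt \<G> (\<sigma> F)" "\<sigma> G = \<sigma> F \<cdot>\<^bsub>\<G>\<^esub> e d"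
    by (auto simp: prefix_le_def)
  have "d \<in> \<phi>m ` Mor C" using d(1) bij_mor unfolding bij_betw_def by simp
  then obtain c where c: "c \<in> Mor C" "d = \<phi>m c" by blast
  have "\<phi>o (src C c) = \<phi>o (tgt \<G> F)" using d(2) c \<sigma>_props[OF F] by (simp add: src_map)
  then have s: "src C c = tgt \<G> F"
    using bij_ob c(1) mor_from_props[OF F] unfolding bij_betw_def inj_on_def by blast
  have "\<sigma> G = \<sigma> (F \<cdot>\<^bsub>\<G>\<^esub> e c)" using d c \<sigma>_mult[OF F c(1) s] by simp
  moreover have "inj_on \<sigma> V" using bij_garside_automorphism by (simp add: bij_betw_def)
  ultimately have "G = F \<cdot>\<^bsub>\<G>\<^esub> e c" using G mult_emb[OF F c(1) s] by (simp add: inj_on_eq_iff)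
  then show "prefix_le F G" using c(1) s by (auto simp: prefix_le_def)
qed

lemma prefix_le_mult:
  "\<lbrakk>c \<in> Mor C; src C c = tgt \<G> F\<rbrakk> \<Longrightarrow> prefix_le F (F \<cdot>\<^bsub>\<G>\<^esub> e c)"
  by (auto simp: prefix_le_def)

lemma prefix_le_trans:
  assumes "prefix_le F G" "prefix_le G H" "F \<in> V"
  shows "prefix_le F H"
proof -
  obtain c where c: "c \<in> Mor C" "src C c = tgt \<G> F" "G = F \<cdot>\<^bsub>\<G>\<^esub> e c"
    using assms(1) by (auto simp: prefix_le_def)
  obtain d where d: "d \<in> Mor C" "src C d = tgt \<G> G" "H = G \<cdot>\<^bsub>\<G>\<^esub> e d"
    using assms(2) by (auto simp: prefix_le_def)
  have t: "src C d = tgt C c" using d(2) c mult_emb[OF assms(3) c(1,2)] by simp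
  have "H = F \<cdot>\<^bsub>\<G>\<^esub> e (c \<cdot> d)" using d(3) c(3) mult_emb_emb[OF assms(3) c(1,2) d(1) t] by simp
  then show ?thesis using c d t prefix_le_mult[of "c \<cdot> d" F] by simp
qed

text \<open>The two quotients compose to an identity by faithfulness. Lengths add up, so the first
  quotient has length 0 and is itself an identity.\<close>

lemma prefix_le_antisym:
  assumes F: "F \<in> V" and "prefix_le F G" "prefix_le G F"
  shows "F = G"
proof -
  obtain c where c: "c \<in> Mor C" "src C c = tgt \<G> F" "G = F \<cdot>\<^bsub>\<G>\<^esub> e c"
    using assms(2) by (auto simp: prefix_le_def)
  obtain d where d: "d \<in> Mor C" "src C d = tgt \<G> G" "F = G \<cdot>\<^bsub>\<G>\<^esub> e d"
    using assms(3) by (auto simp: prefix_le_def)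
  have t: "src C d = tgt C c" using d(2) c mult_emb[OF F c(1,2)] by simp
  have "F \<cdot>\<^bsub>\<G>\<^esub> e (c \<cdot> d) = F" using d(3) c(3) mult_emb_emb[OF F c(1,2) d(1) t] by simp
  then have "F \<cdot>\<^bsub>\<G>\<^esub> e (c \<cdot> d) = F \<cdot>\<^bsub>\<G>\<^esub> e (ident C (tgt \<G> F))" using mult_ident[OF F] by simp
  then have cd: "c \<cdot> d = ident C (tgt \<G> F)"
    using mult_emb_cancel[OF F, of "c \<cdot> d" "ident C (tgt \<G> F)"] c(1,2) d(1) t mor_from_props[OF F] by simp
  obtain l :: "'m \<Rightarrow> nat" where
    l: "\<forall>f\<in>Mor C. \<forall>g\<in>Mor C. tgt C f = src C g \<longrightarrow> l (f \<cdot> g) = l f + l g"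
      "\<forall>f\<in>Mor C. l f = 0 \<longleftrightarrow> f \<in> ident C ` Ob C"
    using is_homogeneous unfolding homogeneous_def by blast
  have "l (c \<cdot> d) = 0" using l(2) cd mor_from_props[OF F] by simp
  then have "l c = 0" using l(1)[rule_format, OF c(1) d(1) t[symmetric]] by simp
  then obtain y where "y \<in> Ob C" "c = ident C y" using l(2) c(1) by blast
  then show ?thesis using c mult_ident[OF F] by simp
qed

section \<open>The shift, cofinality of its orbits, and joins\<close>

definition garside_shift :: "int \<Rightarrow> ('o, 'm) zigzag set \<Rightarrow> ('o, 'm) zigzag set" where
  "garside_shift = int_iterate V \<sigma>"

lemma garside_shift_1: "F \<in> V \<Longrightarrow> garside_shift 1 F = F \<cdot>\<^bsub>\<G>\<^esub> e (\<Delta> (tgt \<G> F))"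
  using int_iterate_1[OF bij_garside_automorphism] \<sigma>_eq by (simp add: garside_shift_def)

sublocale shifted_order V prefix_le garside_shift
proof
  fix u v w i j
  assume u: "u \<in> V"
  show "prefix_le u u" using prefix_le_mult[of "ident C (tgt \<G> u)" u] mult_ident[OF u] mor_from_props[OF u] by simp
  show "garside_shift i u \<in> V"
    unfolding garside_shift_def by (rule int_iterate_in[OF bij_garside_automorphism u])
  show "garside_shift 0 u = u"
    unfolding garside_shift_def by (rule int_iterate_0[OF u])
  show "garside_shift i (garside_shift j u) = garside_shift (i + j) u"
    unfolding garside_shift_def by (rule int_iterate_add[OF bij_garside_automorphism u])
  show "prefix_le u (garside_shift 1 u)"
    unfolding garside_shift_1[OF u] using mor_from_props[OF u] by (intro prefix_le_mult) (simp_all add: Delta_in src_Delta)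
  assume v: "v \<in> V"
  show "prefix_le (garside_shift 1 u) (garside_shift 1 v) \<longleftrightarrow> prefix_le u v"
    unfolding garside_shift_def int_iterate_1[OF bij_garside_automorphism u]
      int_iterate_1[OF bij_garside_automorphism v] by (rule prefix_le_\<sigma>_iff[OF u v])
qed (rule prefix_le_antisym, assumption+, rule prefix_le_trans, assumption+)

text \<open>Induction on length: an identity needs no shift, an atom is simple and needs one, and
  for a product the exponents of the shorter factors add up.\<close>

lemma mult_emb_cofinal:
  assumes "F \<in> V" "c \<in> Mor C" "src C c = tgt \<G> F"
  shows "\<exists>k. prefix_le (F \<cdot>\<^bsub>\<G>\<^esub> e c) (garside_shift k F)"
proof -
  obtain l :: "'m \<Rightarrow> nat" where
    l: "\<forall>f\<in>Mor C. \<forall>g\<in>Mor C. tgt C f = src C g \<longrightarrow> l (f \<cdot> g) = l f + l g"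
      "\<forall>f\<in>Mor C. l f = 0 \<longleftrightarrow> f \<in> ident C ` Ob C"
    using is_homogeneous unfolding homogeneous_def by blast
  show ?thesis
    using assms
  proof (induction "l c" arbitrary: F c rule: less_induct)
    case less
    note F = less.prems(1) and c = less.prems(2,3)
    consider y where "y \<in> Ob C" "c = ident C y" | "atom C c"
      | f g where "nontrivial C f" "nontrivial C g" "tgt C f = src C g" "c = f \<cdot> g"
      using c(1) unfolding atom_def nontrivial_def by blast
    then show ?case
    proof cases
      case 1
      then have "F \<cdot>\<^bsub>\<G>\<^esub> e c = garside_shift 0 F" using c mult_ident[OF F] F by simp
      then show ?thesis using F by (intro exI[of _ 0]) simp
    next
      case 2
      then obtain h where h: "h \<in> Mor C" "src C h = tgt C c" "c \<cdot> h = \<Delta> (tgt \<G> F)"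
        using atoms_simple[OF 2] c(2) unfolding simples_def by auto
      have "garside_shift 1 F = F \<cdot>\<^bsub>\<G>\<^esub> e c \<cdot>\<^bsub>\<G>\<^esub> e h"
        using mult_emb_emb[OF F c h(1,2)] garside_shift_1[OF F] h(3) by simp
      then have "prefix_le (F \<cdot>\<^bsub>\<G>\<^esub> e c) (garside_shift 1 F)"
        using h prefix_le_mult[of h "F \<cdot>\<^bsub>\<G>\<^esub> e c"] mult_emb[OF F c] by simp
      then show ?thesis by blast
    next
      case 3
      then have f: "f \<in> Mor C" "src C f = tgt \<G> F" and g: "g \<in> Mor C" "src C g = tgt C f"
        using c by (auto simp: nontrivial_def)
      have "l c = l f + l g" "l f \<noteq> 0" "l g \<noteq> 0"
        using 3 l(1)[rule_format, OF f(1) g(1) g(2)[symmetric]] l(2) f(1) g(1)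
        by (simp_all add: nontrivial_def)
      then have less_l: "l f < l c" "l g < l c" by linarith+
      let ?H = "F \<cdot>\<^bsub>\<G>\<^esub> e f"
      have H: "?H \<in> V" "src C g = tgt \<G> ?H" using mult_emb[OF F f] g by simp_all
      obtain i where i: "prefix_le ?H (garside_shift i F)"
        using less.hyps[OF less_l(1) F f] by blast
      obtain j where j: "prefix_le (?H \<cdot>\<^bsub>\<G>\<^esub> e g) (garside_shift j ?H)"
        using less.hyps[OF less_l(2) H(1) g(1) H(2)] by blast
      have "prefix_le (?H \<cdot>\<^bsub>\<G>\<^esub> e g) (garside_shift (j + i) F)"
        by (rule le_shift_trans[OF j i]) (use mult_emb[OF H(1) g(1) H(2)] H F in simp_all)
      moreover have "?H \<cdot>\<^bsub>\<G>\<^esub> e g = F \<cdot>\<^bsub>\<G>\<^esub> e c" using mult_emb_emb[OF F f g] 3(4) by simp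
      ultimately show ?thesis by auto
    qed
  qed
qed

text \<open>Letter by letter: a forward letter moves upwards and costs nothing. After a backward
  letter \<open>c\<close> the old position is the new one times \<open>c\<close>, which lies below a
  translate of the new one by \<open>mult_emb_cofinal\<close>.\<close>

lemma mult_path_cofinal:
  assumes "F \<in> V" "is_path C (tgt \<G> F) w y"
  shows "\<exists>k. prefix_le F (garside_shift k (F \<cdot>\<^bsub>\<G>\<^esub> zclass C (tgt \<G> F, w, y)))"
  using assms
proof (induction w arbitrary: F)
  case Nil
  then have "F \<cdot>\<^bsub>\<G>\<^esub> zclass C (tgt \<G> F, [], y) = F"
    using mor_from_props[of F] E.ident_right[of F] by (simp add: ident_env)
  then show ?case using Nil by (intro exI[of _ 0]) simp
next
  case (Cons a w)
  note F = Cons.prems(1)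
  define z where "z = letter_tgt C a"
  have a: "is_path C (tgt \<G> F) [a] z" and w: "is_path C z w y"
    using Cons.prems(2) is_path_endpoints by (auto simp: z_def)
  let ?A = "zclass C (tgt \<G> F, [a], z)"
  let ?H = "F \<cdot>\<^bsub>\<G>\<^esub> ?A"
  have H: "?H \<in> V" "tgt \<G> ?H = z"
    using F a zclass_Mor[OF a] by (simp_all add: mor_from_def)
  have FH: "F \<cdot>\<^bsub>\<G>\<^esub> zclass C (tgt \<G> F, a # w, y) = ?H \<cdot>\<^bsub>\<G>\<^esub> zclass C (z, w, y)"
    using cmp_zclass[OF a w] a w zclass_Mor[OF a] zclass_Mor[OF w] mor_from_props[OF F] by (simp add: E.cmp_assoc)
  obtain i where i: "prefix_le ?H (garside_shift i (?H \<cdot>\<^bsub>\<G>\<^esub> zclass C (z, w, y)))"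
    using Cons.IH[OF H(1)] H(2) w by auto
  have "\<exists>j. prefix_le F (garside_shift j ?H)"
  proof (cases a)
    case (Fwd c)
    then have c: "c \<in> Mor C" "src C c = tgt \<G> F" and "?A = e c"
      using a by (auto simp: env_emb_def z_def)
    then have "prefix_le F (garside_shift 0 ?H)" using prefix_le_mult[OF c] H(1) by simp
    then show ?thesis by blast
  next
    case (Bwd c)
    then have c: "c \<in> Mor C" "tgt C c = tgt \<G> F" "src C c = tgt \<G> ?H" and z: "z = src C c"
      using a H(2) by (auto simp: z_def)
    have ob: "tgt \<G> F \<in> Ob C" using mor_from_props[OF F] by blast
    define t where "t = tgt \<G> F"
    have t: "t \<in> Ob C" "tgt C c = t" using mor_from_props[OF F] c(2) by (simp_all add: t_def)
    have p: "is_path C z [Fwd c] t" using c(1) t z by simp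
    have At: "is_path C t [Bwd c] z" using a Bwd by (simp add: t_def)
    have "?A \<cdot>\<^bsub>\<G>\<^esub> e c = zclass C (t, [Bwd c] @ [Fwd c], t)"
      using cmp_zclass[OF At p] Bwd t(2) z by (simp add: env_emb_def t_def)
    also have "\<dots> = ident \<G> t"
      using zclass_step[OF relator_inv_left[OF c(1)], of t "[]" "[]" t] c(1) t
      by (simp add: ident_env)
    finally have Ac: "?A \<cdot>\<^bsub>\<G>\<^esub> e c = ident \<G> (tgt \<G> F)" by (simp add: t_def)
    have "?H \<cdot>\<^bsub>\<G>\<^esub> e c = F \<cdot>\<^bsub>\<G>\<^esub> (?A \<cdot>\<^bsub>\<G>\<^esub> e c)"
      by (rule E.cmp_assoc) (use mor_from_props[OF F] a zclass_Mor[OF a] c(1) z in \<open>simp_all add: env_emb_props\<close>)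
    then have "?H \<cdot>\<^bsub>\<G>\<^esub> e c = F"
      using mor_from_props[OF F] E.ident_right[of F] by (simp add: Ac)
    then show ?thesis using mult_emb_cofinal[OF H(1) c(1,3)] by simp
  qed
  then obtain j where j: "prefix_le F (garside_shift j ?H)" by blast
  have "?H \<cdot>\<^bsub>\<G>\<^esub> zclass C (z, w, y) \<in> V"
    by (rule mult_in[OF H(1) zclass_Mor[OF w]]) (use H(2) w in simp)
  then have "prefix_le F (garside_shift (j + i) (?H \<cdot>\<^bsub>\<G>\<^esub> zclass C (z, w, y)))"
    by (intro le_shift_trans[OF j i]) (use F H in simp_all)
  then show ?case unfolding FH by blast
qed

lemma cofinal:
  assumes F: "F \<in> V" and G: "G \<in> V"
  shows "\<exists>k. prefix_le F (garside_shift k G)"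
proof -
  note FG = mor_from_props[OF F] mor_from_props[OF G]
  obtain I where I: "I \<in> Mor \<G>" "src \<G> I = tgt \<G> F" "tgt \<G> I = src \<G> F" "F \<cdot>\<^bsub>\<G>\<^esub> I = ident \<G> (src \<G> F)"
    using env_inverse[of F] FG by metis
  have IG: "I \<cdot>\<^bsub>\<G>\<^esub> G \<in> Mor \<G>" "src \<G> (I \<cdot>\<^bsub>\<G>\<^esub> G) = tgt \<G> F" using I FG by simp_all
  obtain z w y where w: "is_path C z w y" "I \<cdot>\<^bsub>\<G>\<^esub> G = zclass C (z, w, y)"
    by (rule env_MorE[OF IG(1)])
  have "F \<cdot>\<^bsub>\<G>\<^esub> (I \<cdot>\<^bsub>\<G>\<^esub> G) = G"
    using I FG E.ident_left[of G] by (simp flip: E.cmp_assoc)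
  moreover have "z = tgt \<G> F" using w IG(2) by simp
  ultimately show ?thesis using mult_path_cofinal[OF F, of w y] w by simp
qed

sublocale shifted_join_semilattice V prefix_le garside_shift
proof
  fix F G assume F: "F \<in> V" and G: "G \<in> V"
  obtain k where k: "prefix_le F (garside_shift k G)" using cofinal[OF F G] by blast
  \<comment> \<open>Lying below \<open>F\<close> needs a nonpositive exponent, lying below
    \<open>G\<close> one that is at most \<open>- k\<close>.\<close>
  define L where "L = garside_shift (- max k 0) F"
  have L: "L \<in> V" using F by (simp add: L_def)
  have LF: "prefix_le L F" using F by (simp add: L_def shift_left_iff le_shift)
  have LG: "prefix_le L G"
    using le_shift_trans[OF k, of 0 G "max k 0"] F G by (simp add: L_def shift_left_iff)
  obtain a where a: "a \<in> Mor C" "src C a = tgt \<G> L" "F = L \<cdot>\<^bsub>\<G>\<^esub> e a"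
    using LF by (auto simp: prefix_le_def)
  obtain b where b: "b \<in> Mor C" "src C b = tgt \<G> L" "G = L \<cdot>\<^bsub>\<G>\<^esub> e b"
    using LG by (auto simp: prefix_le_def)
  have tF: "tgt \<G> F = tgt C a" and tG: "tgt \<G> G = tgt C b"
    using mult_emb[OF L a(1,2)] mult_emb[OF L b(1,2)] a(3) b(3) by simp_all
  have ab: "src C a = src C b" using a b by simp
  obtain p q where p: "p \<in> Mor C" "src C p = tgt C a" and q: "q \<in> Mor C" "src C q = tgt C b"
    and pq: "a \<cdot> p = b \<cdot> q"
    and least: "\<And>c d. \<lbrakk>c \<in> Mor C; d \<in> Mor C; src C c = tgt C a; src C d = tgt C b; a \<cdot> c = b \<cdot> d\<rbrakk>
      \<Longrightarrow> \<exists>r\<in>Mor C. src C r = tgt C p \<and> a \<cdot> c = a \<cdot> p \<cdot> r"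
    by (rule join_from[OF a(1) b(1) ab]) blast
  define H where "H = L \<cdot>\<^bsub>\<G>\<^esub> e (a \<cdot> p)"
  have m: "a \<cdot> p \<in> Mor C" "src C (a \<cdot> p) = tgt \<G> L" "tgt C (a \<cdot> p) = tgt C p" using a p by simp_all
  have H: "H \<in> V" "tgt \<G> H = tgt C p" using mult_emb[OF L m(1,2)] m(3) by (simp_all add: H_def)
  have Hp: "H = F \<cdot>\<^bsub>\<G>\<^esub> e p" using mult_emb_emb[OF L a(1,2) p] a(3) by (simp add: H_def)
  have Hq: "H = G \<cdot>\<^bsub>\<G>\<^esub> e q" using mult_emb_emb[OF L b(1,2) q] b(3) pq by (simp add: H_def)
  have "prefix_le F H" unfolding Hp using p tF by (intro prefix_le_mult) simp_all
  moreover have "prefix_le G H" unfolding Hq using q tG by (intro prefix_le_mult) simp_all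
  moreover have "prefix_le H T" if T: "T \<in> V" "prefix_le F T" "prefix_le G T" for T
  proof -
    obtain c where c: "c \<in> Mor C" "src C c = tgt C a" "T = F \<cdot>\<^bsub>\<G>\<^esub> e c"
      using T(2) tF by (auto simp: prefix_le_def)
    obtain d where d: "d \<in> Mor C" "src C d = tgt C b" "T = G \<cdot>\<^bsub>\<G>\<^esub> e d"
      using T(3) tG by (auto simp: prefix_le_def)
    have Tc: "T = L \<cdot>\<^bsub>\<G>\<^esub> e (a \<cdot> c)" using mult_emb_emb[OF L a(1,2) c(1,2)] a(3) c(3) by simp
    have Td: "T = L \<cdot>\<^bsub>\<G>\<^esub> e (b \<cdot> d)" using mult_emb_emb[OF L b(1,2) d(1,2)] b(3) d(3) by simp
    \<comment> \<open>Both products describe \<open>T\<close> as seen from \<open>L\<close>; by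
      faithfulness they agree in the category, where \<open>a \<cdot> p\<close> is the join of
      \<open>a\<close> and \<open>b\<close>.\<close>
    have "a \<cdot> c = b \<cdot> d"
      using mult_emb_cancel[OF L, of "a \<cdot> c" "b \<cdot> d"] Tc Td a b c d by simp
    then obtain r where r: "r \<in> Mor C" "src C r = tgt C p" "a \<cdot> c = a \<cdot> p \<cdot> r"
      using least[OF c(1) d(1) c(2) d(2)] by blast
    have "T = H \<cdot>\<^bsub>\<G>\<^esub> e r"
      unfolding H_def using mult_emb_emb[OF L m(1,2) r(1)] r(2,3) m(3) Tc by simp
    then show ?thesis using r H prefix_le_mult[of r H] by simp
  qed
  ultimately show "\<exists>w\<in>V. prefix_le F w \<and> prefix_le G w \<and>
      (\<forall>t\<in>V. prefix_le F t \<longrightarrow> prefix_le G t \<longrightarrow> prefix_le w t)"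
    using H(1) by blast
qed

section \<open>Identification of the Cayley graph and its quotient\<close>

lemma simple_step_iff:
  assumes F: "F \<in> V" and G: "G \<in> V"
  shows "(\<exists>s\<in>simples C \<phi>o \<Delta>. tgt \<G> F = src C s \<and> G = F \<cdot>\<^bsub>\<G>\<^esub> e s) \<longleftrightarrow>
    prefix_le F G \<and> prefix_le G (garside_shift 1 F)" (is "?l \<longleftrightarrow> ?r")
proof
  assume ?l
  then obtain s h where s: "s \<in> Mor C" "src C s = tgt \<G> F" "G = F \<cdot>\<^bsub>\<G>\<^esub> e s"
    and h: "h \<in> Mor C" "src C h = tgt C s" "s \<cdot> h = \<Delta> (src C s)"
    by (auto simp: simples_def)
  have "garside_shift 1 F = G \<cdot>\<^bsub>\<G>\<^esub> e h"
    unfolding garside_shift_1[OF F] s(3) using mult_emb_emb[OF F s(1,2) h(1,2)] h(3) s(2) by simp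
  moreover have "tgt \<G> G = tgt C s" unfolding s(3) using mult_emb[OF F s(1,2)] by simp
  ultimately show ?r
    using prefix_le_mult[OF s(1,2)] prefix_le_mult[OF h(1), of G] h(2) s(3) by simp
next
  assume ?r
  then obtain c d where c: "c \<in> Mor C" "src C c = tgt \<G> F" "G = F \<cdot>\<^bsub>\<G>\<^esub> e c"
    and d: "d \<in> Mor C" "src C d = tgt \<G> G" "garside_shift 1 F = G \<cdot>\<^bsub>\<G>\<^esub> e d"
    by (auto simp: prefix_le_def)
  have t: "src C d = tgt C c" using d(2) c(3) mult_emb[OF F c(1,2)] by simp
  have "F \<cdot>\<^bsub>\<G>\<^esub> e (c \<cdot> d) = F \<cdot>\<^bsub>\<G>\<^esub> e (\<Delta> (tgt \<G> F))"
    using mult_emb_emb[OF F c(1,2) d(1) t] c(3) d(3) garside_shift_1[OF F] by simp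
  \<comment> \<open>Cancelling \<open>F\<close> turns the position of \<open>G\<close> between
    \<open>F\<close> and its shift into a factorization of the Garside element in the category;
    \<open>d\<close> is then the complement that makes \<open>c\<close> simple.\<close>
  then have cd: "c \<cdot> d = \<Delta> (src C c)"
    using mult_emb_cancel[OF F, of "c \<cdot> d" "\<Delta> (tgt \<G> F)"] c d t mor_from_props[OF F]
    by (simp add: Delta_in src_Delta)
  have "tgt C d = \<phi>o (src C c)"
    using tgt_cmp[OF c(1) d(1) t[symmetric]] cd tgt_Delta[OF src_in[OF c(1)]] by simp
  then have "c \<in> simples C \<phi>o \<Delta>" using c d t cd by (auto simp: simples_def)
  then show ?l using c by (intro bexI[of _ c]) simp_all
qed

lemma weak_cayley_graph_eq: "weak_cayley_graph C x (simples C \<phi>o \<Delta>) = \<Gamma>"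
proof -
  have "(\<exists>s\<in>simples C \<phi>o \<Delta>. tgt \<G> G = src C s \<and> F = G \<cdot>\<^bsub>\<G>\<^esub> e s \<or>
      tgt \<G> F = src C s \<and> G = F \<cdot>\<^bsub>\<G>\<^esub> e s) \<longleftrightarrow> close F G"
    if "F \<in> V" "G \<in> V" for F G
    using simple_step_iff[OF that] simple_step_iff[OF that(2,1)] unfolding close_def by blast
  then show ?thesis unfolding weak_cayley_graph_def Let_def by auto
qed

lemma weakly_modular_weak_cayley: "weakly_modular (weak_cayley_graph C x (simples C \<phi>o \<Delta>))"
  unfolding weak_cayley_graph_eq by (rule weakly_modular_graph)

lemma weakly_modular_weak_cayley_quotient:
  "weakly_modular (weak_cayley_quotient C \<phi>o \<phi>m \<Delta> x (simples C \<phi>o \<Delta>))"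
proof -
  have "cyclic_orbits V \<sigma> = shift_orbit ` V"
    unfolding cyclic_orbits_eq[OF bij_garside_automorphism] shift_orbit_def
    unfolding garside_shift_def ..
  then show ?thesis
    unfolding weak_cayley_quotient_def weak_cayley_graph_eq by (simp only: weakly_modular_quotient)
qed

text \<open>With one object, every element of \<open>V\<close> is multiplied by the same group
  element \<open>e (\<Delta> x)\<close>, so its orbit under right multiplication is a left coset of
  the cyclic subgroup which that element generates.\<close>

lemma lcosets_eq_shift_orbits:
  assumes ob: "Ob C = {x}"
  defines "W \<equiv> weak_garside_group C x"
  shows "lcosets\<^bsub>W\<^esub> (generate W {e (\<Delta> x)}) = shift_orbit ` V"
proof -
  interpret W: group W unfolding W_def by (rule group_weak_garside_group[OF base_in])
  let ?D = "e (\<Delta> x)"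
  have tgt: "tgt \<G> F = x" if "F \<in> V" for F using mor_from_props[OF that] ob by simp
  have carr: "carrier W = V"
    using tgt by (auto simp: W_def vertex_group_def mor_from_def)
  have mult: "F \<otimes>\<^bsub>W\<^esub> G = F \<cdot>\<^bsub>\<G>\<^esub> G" for F G by (simp add: W_def vertex_group_def)
  have D: "?D \<in> carrier W"
    unfolding carr using base_in by (simp add: mor_from_def env_emb_props Delta_in src_Delta)
  have step: "garside_shift 1 F = F \<otimes>\<^bsub>W\<^esub> ?D" if "F \<in> V" for F
    using garside_shift_1[OF that] tgt[OF that] by (simp add: mult)
  have shift: "garside_shift k F = F \<otimes>\<^bsub>W\<^esub> ?D [^]\<^bsub>W\<^esub> k" if F: "F \<in> V" for k :: int and F
  proof (induction k rule: int_induct[of _ 0])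
    case base
    show ?case using F carr by simp
  next
    case (step1 k)
    have "garside_shift (k + 1) F = garside_shift 1 (garside_shift k F)"
      using F by (simp add: add.commute)
    also have "\<dots> = garside_shift k F \<otimes>\<^bsub>W\<^esub> ?D" by (rule step) (use F in simp)
    also have "\<dots> = F \<otimes>\<^bsub>W\<^esub> (?D [^]\<^bsub>W\<^esub> k \<otimes>\<^bsub>W\<^esub> ?D)"
      unfolding step1.IH using F[folded carr] D by (simp add: W.m_assoc)
    finally show ?case using W.int_pow_mult[OF D, of k 1] D by simp
  next
    case (step2 k)
    \<comment> \<open>Negative exponents are reached by comparing both sides after multiplication by
      \<open>?D\<close> and cancelling it on the right.\<close>
    have "garside_shift (k - 1) F \<otimes>\<^bsub>W\<^esub> ?D = garside_shift k F"
      using step[of "garside_shift (k - 1) F"] F by simp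
    also have "\<dots> = F \<otimes>\<^bsub>W\<^esub> ?D [^]\<^bsub>W\<^esub> (k - 1 + 1)" using step2 by simp
    also have "\<dots> = F \<otimes>\<^bsub>W\<^esub> ?D [^]\<^bsub>W\<^esub> (k - 1) \<otimes>\<^bsub>W\<^esub> ?D"
      unfolding W.int_pow_mult[OF D] using F[folded carr] D by (simp add: W.m_assoc)
    finally show ?case
      using s_in[OF F, folded carr, of "k - 1"] F[folded carr] D by simp
  qed
  have "F <#\<^bsub>W\<^esub> generate W {?D} = shift_orbit F" if "F \<in> V" for F
    unfolding l_coset_def W.generate_pow[OF D] shift_orbit_def shift[OF that] by blast
  then show ?thesis unfolding LCOSETS_def carr by auto
qed

end

theorem theorem4:
  fixes C :: "('o, 'm) cat" and \<phi>o :: "'o \<Rightarrow> 'o" and \<phi>m :: "'m \<Rightarrow> 'm" and \<Delta> :: "'o \<Rightarrow> 'm" and x :: 'o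
  assumes "homogeneous_garside C \<phi>o \<phi>m \<Delta>" and "x \<in> Ob C"
  defines "S \<equiv> simples C \<phi>o \<Delta>" and "G \<equiv> weak_garside_group C x"
  shows "weakly_modular (weak_cayley_graph C x S) \<and>
         weakly_modular (weak_cayley_quotient C \<phi>o \<phi>m \<Delta> x S) \<and>
         (Ob C = {x} \<longrightarrow>
            weakly_modular (cayley_graph G (env_emb C ` S)) \<and>
            weakly_modular (quotient_graph (cayley_graph G (env_emb C ` S))
                              (lcosets\<^bsub>G\<^esub> (generate G {env_emb C (\<Delta> x)}))))"
proof -
  interpret based_garside C \<phi>o \<phi>m \<Delta> x
    using assms(1,2) by (simp add: based_garside_def based_garside_axioms_def)
  have "weakly_modular (cayley_graph G (env_emb C ` S)) \<and>
      weakly_modular (quotient_graph (cayley_graph G (env_emb C ` S))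
        (lcosets\<^bsub>G\<^esub> (generate G {env_emb C (\<Delta> x)})))" if ob: "Ob C = {x}"
  proof -
    have "S \<subseteq> Mor C" by (auto simp: S_def simples_def)
    then have "cayley_graph G (env_emb C ` S) = \<Gamma>"
      using weak_cayley_graph_single[OF ob] weak_cayley_graph_eq by (simp add: S_def G_def)
    then show ?thesis
      using weakly_modular_graph weakly_modular_quotient lcosets_eq_shift_orbits[OF ob]
      by (simp add: G_def)
  qed
  then show ?thesis
    using weakly_modular_weak_cayley weakly_modular_weak_cayley_quotient by (simp add: S_def)
qed

end
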